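(* Let $f$ be an isometry of $\mathbb{H}^3$ induced by $A\in GL(2,\mathbb{C})$. Define $$c(A)=\frac{(\mathrm{trace}\,A)^2}{\det A}.$$ I. Suppose $f$ is orientation-preserving. (i) If $c(A)$ is in $\mathbb{C}-\mathbb{R}$, then $f$ is a $1$-rotatory hyperbolic, and is different from a stretch half-turn. (ii) If $c(A)$ is in $\mathbb{R}$, $|c(A)-2|>2$, then $f$ is a stretch or a stretch half-turn according as $c(A)>0$ or $c(A)<0$. (iii) If $c(A)$ is in $\mathbb{R}-\{0\}$, $|c(A)-2|<2$, then $f$ is a $1$-rotatory elliptic. (iv) If $c(A)=0$, then $f$ is a half-turn. (v) If $c(A)$ is in $\mathbb{R}-\{0\}$, $|c(A)-2|=2$, $A\neq\lambda I$, then $f$ is a translation. (vi) If $c(A)$ is in $\mathbb{R}-\{0\}$, $|c(A)-2|=2$, $A=\lambda I$, then $f$ is the identity. II. Suppose $f$ is orientation-reversing. Let $B=A\bar A$. Then $c(B)$ is a real positive number. (i) If $|c(B)-2|<2$, then $f$ is a $1$-rotatory elliptic inversion. (ii) If $|c(B)-2|>2$, then $f$ is a $0$-rotatory hyperbolic inversion. (iii) If $|c(B)-2|=2$ and $B\neq\lambda I$, then $f$ is a $0$-rotatory parabolic inversion. (iv) If $|c(B)-2|=2$ and $B=\lambda I$, then $f$ acts as an inversion in a circle, or an antipodal map. In both cases $f$ is an elliptic inversion. These cases are detected as follows. If there exists a non-zero $u$ in $\mathbb{C}$, unique up to a non-zero real multiple, such that the matrix $uA$ is of the form $\begin{pmatrix}a&b\\c&-\bar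 a\end{pmatrix}$, where $b,c$ are reals, then $f$ acts as an inversion in a circle, resp. antipodal map, according as $\det uA<0$, resp. $\det uA>0$. The inversion in a circle is a $0$-rotatory elliptic inversion and the antipodal map is a $1$-rotatory elliptic inversion of $\mathbb{H}^3$.
   Context: The conformal boundary of $\mathbb{H}^3$ is identified with $\hat{\mathbb{C}}=\mathbb{C}\cup\{\infty\}$, and isometries of $\mathbb{H}^3$ are identified with the transformations they induce on $\hat{\mathbb{C}}$. For $A=\begin{pmatrix}a&b\\c&d\end{pmatrix}\in GL(2,\mathbb{C})$, the orientation-preserving isometry induced by $A$ is $z\mapsto\frac{az+b}{cz+d}$, and the orientation-reversing isometry induced by $A$ is $z\mapsto\frac{a\bar z+b}{c\bar z+d}$. $\bar A$ denotes the entrywise complex conjugate of $A$, and $I$ the identity matrix; "$M=\lambda I$" (resp. "$M\ne\lambda I$") means that $M$ is (resp. is not) a scalar matrix. Names for orientation-preserving transformations, up to conjugation by Möbius transformations $w\mapsto\frac{aw+b}{cw+d}$: a half-turn is conjugate to $w\mapsto -w$; a stretch is conjugate to $w\mapsto\kappa w$ with $\kappa>0$ real, $\kappa\ne1$; a stretch half-turn is conjugate to $w\mapsto\kappa w$ with $\kappa<0$ real, $\kappa\neq-1$; a translation is conjugate to $w\mapsto w+\beta$, $\beta\neq0$. Circles are circles of $\hat{\mathbb{C}}$ (lines together with $\infty$ included). An antipodal map is an orientation-reversing map of order $2$ without a fixed point on $\hat{\mathbb{C}}$. The "$k$-rotatory" terminology: let $\mathbb{V}$ be a real vector space of dimension $4$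 with a quadratic form $Q$ of signature $(1,3)$, and let $\mathbb{H}^3$ be one component of $\{Q=1\}$; isometries of $\mathbb{H}^3$ are identified with the elements $T\in O(Q)$ preserving this component. $T$ is elliptic if it has an eigenvector $v$ with $Q(v)>0$, hyperbolic if it has a real eigenvalue $r\ne\pm1$, parabolic if it is not semisimple. Its characteristic polynomial is $(x-1)^l(x+1)^m\prod_{j=1}^s(x^2-2a_jx+1)^{r_j}$ in the elliptic and parabolic cases, and the same with an extra factor $(x-r)(x-r^{-1})$ in the hyperbolic case, with distinct real $a_j$, $|a_j|<1$. Put $k=\sum_jr_j+[\frac m2]$. $T$ is a $k$-rotatory elliptic / hyperbolic / parabolic if $m$ is even, and a $k$-rotatory elliptic / hyperbolic / parabolic inversion if $m$ is odd. An elliptic inversion is a $k$-rotatory elliptic inversion for some $k$.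
   Formalization: In II, "c(B) is real positive" is corrected to "c(B) is real and ≥ 0", and II(iii) additionally assumes c(B) ≠ 0; as printed both fail for A = [[0,i],[1,0]], where c(B) = 0 and f is a 1-rotatory elliptic inversion. *)

theory Defs
  imports "HOL-Analysis.Analysis" "HOL-Computational_Algebra.Polynomial"
begin

section \<open>Transformations of the Riemann sphere\<close>

text \<open>The sphere \<open>\<complex> \<union> {\<infinity>}\<close> is modelled by options, with \<open>None\<close> as \<open>\<infinity>\<close>.\<close>

type_synonym sphere = "complex option"

definition moebius_map :: "complex^2^2 \<Rightarrow> sphere \<Rightarrow> sphere" where
  "moebius_map A p =
     (case p of
        None \<Rightarrow> if A$2$1 = 0 then None else Some (A$1$1 / A$2$1)
      | Some z \<Rightarrow> if A$2$1 * z + A$2$2 = 0 then None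
                  else Some ((A$1$1 * z + A$1$2) / (A$2$1 * z + A$2$2)))"

definition anti_moebius_map :: "complex^2^2 \<Rightarrow> sphere \<Rightarrow> sphere" where
  "anti_moebius_map A p = moebius_map A (map_option cnj p)"

definition tr_inv :: "complex^2^2 \<Rightarrow> complex" where
  "tr_inv A = (trace A)\<^sup>2 / det A"

definition scalar_matrix :: "complex^2^2 \<Rightarrow> bool" where
  "scalar_matrix M \<longleftrightarrow> (\<exists>\<alpha>. M = mat \<alpha>)"

definition moebius_conjugate :: "(sphere \<Rightarrow> sphere) \<Rightarrow> (sphere \<Rightarrow> sphere) \<Rightarrow> bool" where
  "moebius_conjugate f g \<longleftrightarrow> (\<exists>M. det M \<noteq> 0 \<and> moebius_map M \<circ> f = g \<circ> moebius_map M)"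

definition half_turn :: "(sphere \<Rightarrow> sphere) \<Rightarrow> bool" where
  "half_turn f \<longleftrightarrow> moebius_conjugate f (map_option (\<lambda>w. - w))"

definition stretch :: "(sphere \<Rightarrow> sphere) \<Rightarrow> bool" where
  "stretch f \<longleftrightarrow> (\<exists>\<kappa>::real. \<kappa> > 0 \<and> \<kappa> \<noteq> 1 \<and>
     moebius_conjugate f (map_option (\<lambda>w. complex_of_real \<kappa> * w)))"

definition stretch_half_turn :: "(sphere \<Rightarrow> sphere) \<Rightarrow> bool" where
  "stretch_half_turn f \<longleftrightarrow> (\<exists>\<kappa>::real. \<kappa> < 0 \<and> \<kappa> \<noteq> - 1 \<and>
     moebius_conjugate f (map_option (\<lambda>w. complex_of_real \<kappa> * w)))"

definition translation :: "(sphere \<Rightarrow> sphere) \<Rightarrow> bool" where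
  "translation f \<longleftrightarrow> (\<exists>\<beta>::complex. \<beta> \<noteq> 0 \<and>
     moebius_conjugate f (map_option (\<lambda>w. w + \<beta>)))"

text \<open>Inversion in the circle with centre \<open>p\<close> and radius \<open>R\<close>, and in the line through \<open>p\<close>
  with unit direction \<open>u\<close>.\<close>

definition round_circle_inversion :: "complex \<Rightarrow> real \<Rightarrow> sphere \<Rightarrow> sphere" where
  "round_circle_inversion p R q =
     (case q of
        None \<Rightarrow> Some p
      | Some z \<Rightarrow> if z = p then None else Some (p + complex_of_real (R\<^sup>2) / cnj (z - p)))"

definition line_inversion :: "complex \<Rightarrow> complex \<Rightarrow> sphere \<Rightarrow> sphere" where
  "line_inversion p u = map_option (\<lambda>z. p + u\<^sup>2 * cnj (z - p))"

definition circle_inversion :: "(sphere \<Rightarrow> sphere) \<Rightarrow> bool" where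
  "circle_inversion f \<longleftrightarrow>
     (\<exists>p R. R > 0 \<and> f = round_circle_inversion p R) \<or>
     (\<exists>p u. cmod u = 1 \<and> f = line_inversion p u)"

definition antipodal_map :: "(sphere \<Rightarrow> sphere) \<Rightarrow> bool" where
  "antipodal_map f \<longleftrightarrow>
     (\<exists>A. det A \<noteq> 0 \<and> f = anti_moebius_map A) \<and>
     f \<noteq> id \<and> f \<circ> f = id \<and> (\<forall>p. f p \<noteq> p)"

definition inversion_form :: "complex^2^2 \<Rightarrow> bool" where
  "inversion_form M \<longleftrightarrow> M$2$2 = - cnj (M$1$1) \<and> M$1$2 \<in> \<real> \<and> M$2$1 \<in> \<real>"


section \<open>Isometries of hyperbolic 3-space in the linear model\<close>

definition Q :: "real^4 \<Rightarrow> real" where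
  "Q v = (v$1)\<^sup>2 - (v$2)\<^sup>2 - (v$3)\<^sup>2 - (v$4)\<^sup>2"

definition H3 :: "(real^4) set" where
  "H3 = {v. Q v = 1 \<and> v$1 > 0}"

definition H3_isometry :: "(real^4 \<Rightarrow> real^4) \<Rightarrow> bool" where
  "H3_isometry T \<longleftrightarrow> linear T \<and> (\<forall>v. Q (T v) = Q v) \<and> T ` H3 = H3"

text \<open>The conformal boundary of \<open>H3\<close> is the set of rays of the cone \<open>Q v = 0\<close>, \<open>v$1 > 0\<close>.
  The section \<open>v$1 = 1\<close> of this cone is a round 2-sphere, identified with
  \<open>\<complex> \<union> {\<infinity>}\<close> by stereographic projection from the point \<open>(1,0,0,1)\<close>.  The vector below
  spans the ray belonging to a point of \<open>\<complex> \<union> {\<infinity>}\<close>.\<close>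

definition boundary_vector :: "sphere \<Rightarrow> real^4" where
  "boundary_vector p =
     (case p of
        None \<Rightarrow> vector [1, 0, 0, 1]
      | Some z \<Rightarrow> vector [(cmod z)\<^sup>2 + 1, 2 * Re z, 2 * Im z, (cmod z)\<^sup>2 - 1])"

definition induces_on_boundary :: "(real^4 \<Rightarrow> real^4) \<Rightarrow> (sphere \<Rightarrow> sphere) \<Rightarrow> bool" where
  "induces_on_boundary T f \<longleftrightarrow>
     (\<forall>p. \<exists>t>0. T (boundary_vector p) = t *\<^sub>R boundary_vector (f p))"

text \<open>The isometry of \<open>H3\<close> identified with \<open>f\<close> has the property \<open>P\<close>.  The boundary vectors
  span the whole space, and \<open>T\<close> preserves \<open>Q\<close>, so that \<open>T\<close> is determined by \<open>f\<close>.\<close>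

definition as_H3_isometry :: "((real^4 \<Rightarrow> real^4) \<Rightarrow> bool) \<Rightarrow> (sphere \<Rightarrow> sphere) \<Rightarrow> bool" where
  "as_H3_isometry P f \<longleftrightarrow> (\<exists>T. H3_isometry T \<and> induces_on_boundary T f \<and> P T)"

definition charpoly :: "(real^4 \<Rightarrow> real^4) \<Rightarrow> real poly" where
  "charpoly T = det (mat [:0, 1:] - map_matrix (\<lambda>x. [:x:]) (matrix T))"

definition semisimple :: "(real^4 \<Rightarrow> real^4) \<Rightarrow> bool" where
  "semisimple T \<longleftrightarrow>
     (\<forall>U. subspace U \<and> T ` U \<subseteq> U \<longrightarrow>
        (\<exists>W. subspace W \<and> T ` W \<subseteq> W \<and> U \<inter> W = {0} \<and> {u + w |u w. u \<in> U \<and> w \<in> W} = UNIV))"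

definition elliptic :: "(real^4 \<Rightarrow> real^4) \<Rightarrow> bool" where
  "elliptic T \<longleftrightarrow> (\<exists>v \<mu>. T v = \<mu> *\<^sub>R v \<and> Q v > 0)"

definition hyperbolic_eigenvalue :: "(real^4 \<Rightarrow> real^4) \<Rightarrow> real \<Rightarrow> bool" where
  "hyperbolic_eigenvalue T r \<longleftrightarrow> r \<noteq> 1 \<and> r \<noteq> - 1 \<and> (\<exists>v. v \<noteq> 0 \<and> T v = r *\<^sub>R v)"

definition parabolic :: "(real^4 \<Rightarrow> real^4) \<Rightarrow> bool" where
  "parabolic T \<longleftrightarrow> \<not> semisimple T"

text \<open>\<open>p\<close> is \<open>(x - 1)^l (x + 1)^m \<Prod>j (x^2 - 2 a_j x + 1)^(r_j)\<close> with distinct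
  \<open>a_j \<in> (-1,1)\<close>, and \<open>k\<close> is the resulting rotation number.\<close>

definition rotatory_factorization :: "real poly \<Rightarrow> nat \<Rightarrow> nat \<Rightarrow> bool" where
  "rotatory_factorization p k m \<longleftrightarrow>
     (\<exists>(l::nat) (s::nat) (a :: nat \<Rightarrow> real) (r :: nat \<Rightarrow> nat).
        inj_on a {..<s} \<and> (\<forall>j<s. \<bar>a j\<bar> < 1 \<and> r j > 0) \<and>
        p = [:-1, 1:] ^ l * [:1, 1:] ^ m * (\<Prod>j<s. [:1, - 2 * a j, 1:] ^ r j) \<and>
        k = (\<Sum>j<s. r j) + m div 2)"

definition elliptic_type :: "nat \<Rightarrow> nat \<Rightarrow> (real^4 \<Rightarrow> real^4) \<Rightarrow> bool" where
  "elliptic_type k m T \<longleftrightarrow> elliptic T \<and> rotatory_factorization (charpoly T) k m"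

definition hyperbolic_type :: "nat \<Rightarrow> nat \<Rightarrow> (real^4 \<Rightarrow> real^4) \<Rightarrow> bool" where
  "hyperbolic_type k m T \<longleftrightarrow>
     (\<exists>r p. hyperbolic_eigenvalue T r \<and>
        charpoly T = [:- r, 1:] * [:- inverse r, 1:] * p \<and> rotatory_factorization p k m)"

definition parabolic_type :: "nat \<Rightarrow> nat \<Rightarrow> (real^4 \<Rightarrow> real^4) \<Rightarrow> bool" where
  "parabolic_type k m T \<longleftrightarrow> parabolic T \<and> rotatory_factorization (charpoly T) k m"

definition rotatory_elliptic :: "nat \<Rightarrow> (sphere \<Rightarrow> sphere) \<Rightarrow> bool" where
  "rotatory_elliptic k = as_H3_isometry (\<lambda>T. \<exists>m. even m \<and> elliptic_type k m T)"

definition rotatory_hyperbolic :: "nat \<Rightarrow> (sphere \<Rightarrow> sphere) \<Rightarrow> bool" where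
  "rotatory_hyperbolic k = as_H3_isometry (\<lambda>T. \<exists>m. even m \<and> hyperbolic_type k m T)"

definition rotatory_elliptic_inversion :: "nat \<Rightarrow> (sphere \<Rightarrow> sphere) \<Rightarrow> bool" where
  "rotatory_elliptic_inversion k = as_H3_isometry (\<lambda>T. \<exists>m. odd m \<and> elliptic_type k m T)"

definition rotatory_hyperbolic_inversion :: "nat \<Rightarrow> (sphere \<Rightarrow> sphere) \<Rightarrow> bool" where
  "rotatory_hyperbolic_inversion k = as_H3_isometry (\<lambda>T. \<exists>m. odd m \<and> hyperbolic_type k m T)"

definition rotatory_parabolic_inversion :: "nat \<Rightarrow> (sphere \<Rightarrow> sphere) \<Rightarrow> bool" where
  "rotatory_parabolic_inversion k = as_H3_isometry (\<lambda>T. \<exists>m. odd m \<and> parabolic_type k m T)"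

definition elliptic_inversion :: "(sphere \<Rightarrow> sphere) \<Rightarrow> bool" where
  "elliptic_inversion f \<longleftrightarrow> (\<exists>k. rotatory_elliptic_inversion k f)"

end

theory Submission
  imports Defs
begin

text \<open>
  Identifying \<open>real^4\<close> with the Hermitian \<open>2 \<times> 2\<close> matrices turns \<open>Q\<close> into the determinant, and the
  boundary vector of a point with homogeneous coordinates \<open>\<xi>\<close> into \<open>2 \<xi> \<xi>\<^sup>*\<close>. The isometry induced by
  \<open>A\<close> is therefore \<open>X \<mapsto> A X A\<^sup>* / |det A|\<close>, preceded by \<open>X \<mapsto> \<bar>X\<close> in the orientation-reversing
  case. In the basis of matrix units these maps are \<open>A \<otimes> \<bar>A\<close>, with two columns swapped in the
  orientation-reversing case, which gives the characteristic polynomials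
  \<open>x\<^sup>4 - |c| x\<^sup>3 + (2 Re c - 2) x\<^sup>2 - |c| x + 1\<close> with \<open>c = c(A)\<close>, and
  \<open>(x\<^sup>2 - 1) (x\<^sup>2 - \<tau> x + 1)\<close> with \<open>\<tau> = trace (A \<bar>A) / |det A|\<close>, where \<open>\<tau>\<^sup>2 = c(A \<bar>A)\<close>.
  Ellipticity comes from a positive definite fixed matrix: \<open>P P\<^sup>*\<close> if \<open>P\<close> diagonalizes \<open>A\<close> with
  eigenvalues of equal modulus, and \<open>X + T X\<close> if \<open>T\<close> is orientation-reversing and \<open>T\<^sup>2 X = X\<close>.
  If \<open>\<tau> = 2\<close> then \<open>(T\<^sup>2 - 1)\<^sup>3 = 0\<close>, so that semisimplicity would force \<open>T\<^sup>2 = 1\<close>, that is, \<open>A \<bar>A\<close>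
  scalar; and \<open>\<tau> = -2\<close> always makes \<open>A \<bar>A\<close> scalar.
\<close>

section \<open>Matrices of small size\<close>

lemma vector_4 [simp]:
  "(vector [x, y, z, w] :: 'a::zero^4) $ 1 = x"
  "(vector [x, y, z, w] :: 'a::zero^4) $ 2 = y"
  "(vector [x, y, z, w] :: 'a::zero^4) $ 3 = z"
  "(vector [x, y, z, w] :: 'a::zero^4) $ 4 = w"
  by (simp_all add: vector_def)

text \<open>The characteristic polynomials are verified as polynomial identities in the matrix
  entries, which requires an explicit expansion.\<close>

lemma det_4:
  "det (A::'a::comm_ring_1^4^4) =
     A$1$1 * (A$2$2 * (A$3$3 * A$4$4 - A$3$4 * A$4$3) - A$2$3 * (A$3$2 * A$4$4 - A$3$4 * A$4$2)
       + A$2$4 * (A$3$2 * A$4$3 - A$3$3 * A$4$2)) -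
     A$1$2 * (A$2$1 * (A$3$3 * A$4$4 - A$3$4 * A$4$3) - A$2$3 * (A$3$1 * A$4$4 - A$3$4 * A$4$1)
       + A$2$4 * (A$3$1 * A$4$3 - A$3$3 * A$4$1)) +
     A$1$3 * (A$2$1 * (A$3$2 * A$4$4 - A$3$4 * A$4$2) - A$2$2 * (A$3$1 * A$4$4 - A$3$4 * A$4$1)
       + A$2$4 * (A$3$1 * A$4$2 - A$3$2 * A$4$1)) -
     A$1$4 * (A$2$1 * (A$3$2 * A$4$3 - A$3$3 * A$4$2) - A$2$2 * (A$3$1 * A$4$3 - A$3$3 * A$4$1)
       + A$2$3 * (A$3$1 * A$4$2 - A$3$2 * A$4$1))"
proof -
  have f1234: "finite {2::4, 3, 4}" "1 \<notin> {2::4, 3, 4}"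
    by auto
  have f234: "finite {3::4, 4}" "2 \<notin> {3::4, 4}"
    by auto
  have f34: "finite {4::4}" "3 \<notin> {4::4}"
    by auto
  show ?thesis
    unfolding det_def UNIV_4
    unfolding sum_over_permutations_insert[OF f1234]
    unfolding sum_over_permutations_insert[OF f234]
    unfolding sum_over_permutations_insert[OF f34]
    unfolding permutes_sing
    by (simp add: sign_swap_id permutation_swap_id permutation_compose sign_compose sign_id
        swap_id_eq algebra_simps)
qed

lemma matrix_eq_2: "A = B \<longleftrightarrow> A$1$1 = B$1$1 \<and> A$1$2 = B$1$2 \<and> A$2$1 = B$2$1 \<and> A$2$2 = B$2$2"
  for A B :: "'a^2^2"
  by (auto simp: vec_eq_iff forall_2)

lemma matrix_mult_2_nth: "(A ** B) $ i $ j = A$i$1 * B$1$j + A$i$2 * B$2$j"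
  for A B :: "'a::semiring_1^2^2"
  by (simp add: matrix_matrix_mult_def sum_2)

lemma mat_2_nth [simp]:
  "(mat k :: 'a::zero^2^2) $ 1 $ 1 = k" "(mat k :: 'a^2^2) $ 1 $ 2 = 0"
  "(mat k :: 'a^2^2) $ 2 $ 1 = 0" "(mat k :: 'a^2^2) $ 2 $ 2 = k"
  by (simp_all add: mat_def)

lemma trace_2: "trace A = A$1$1 + A$2$2" for A :: "'a::semiring_1^2^2"
  by (simp add: trace_def sum_2)

section \<open>Moebius transformations\<close>

text \<open>Homogeneous coordinates make the Moebius action linear, which confines the case
  distinction for infinity to the passage to and from vectors.\<close>

definition hom_coords :: "sphere \<Rightarrow> complex^2" where
  "hom_coords p = (case p of None \<Rightarrow> vector [1, 0] | Some z \<Rightarrow> vector [z, 1])"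

text \<open>The zero vector, which represents no point, goes to \<open>None\<close>. This agrees
  with the default in \<open>moebius_map\<close>, so \<open>moebius_map_eq_sphere_point\<close>
  holds for every matrix.\<close>

definition sphere_point :: "complex^2 \<Rightarrow> sphere" where
  "sphere_point v = (if v$2 = 0 then None else Some (v$1 / v$2))"

lemma vec_eq_2: "v = w \<longleftrightarrow> v$1 = w$1 \<and> v$2 = w$2" for v w :: "'a^2"
  by (simp add: vec_eq_iff forall_2)

lemma matrix_vector_mult_2_nth: "(A *v v) $ i = A$i$1 * v$1 + A$i$2 * v$2"
  for A :: "'a::semiring_1^2^2"
  by (simp add: matrix_vector_mult_def sum_2)

lemma sphere_point_smult: "c \<noteq> 0 \<Longrightarrow> sphere_point (c *s v) = sphere_point v"
  by (simp add: sphere_point_def)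

lemma hom_coords_sphere_point:
  assumes "v \<noteq> 0"
  obtains c where "c \<noteq> 0" "v = c *s hom_coords (sphere_point v)"
proof (cases "v$2 = 0")
  case True
  with assms that[of "v$1"] show ?thesis
    by (simp add: vec_eq_2 sphere_point_def hom_coords_def)
next
  case False
  with that[of "v$2"] show ?thesis
    by (simp add: vec_eq_2 sphere_point_def hom_coords_def)
qed

lemma hom_coords_nonzero: "hom_coords p \<noteq> 0"
  by (cases p) (simp_all add: hom_coords_def vec_eq_2)

lemma moebius_map_eq_sphere_point: "moebius_map A p = sphere_point (A *v hom_coords p)"
  by (cases p) (simp_all add: moebius_map_def hom_coords_def sphere_point_def matrix_vector_mult_2_nth)

lemma inverse_of_det_nonzero:
  fixes A :: "'a::field^'n^'n"
  assumes "det A \<noteq> 0"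
  obtains A' where "A ** A' = mat 1" "A' ** A = mat 1" "det A' \<noteq> 0"
  using assms invertible_det_nz by (metis invertible_def)

lemma mult_vector_nonzero:
  fixes A :: "complex^2^2"
  assumes "det A \<noteq> 0" "v \<noteq> 0"
  shows "A *v v \<noteq> 0"
  using assms by (metis inverse_of_det_nonzero matrix_vector_mul_assoc matrix_vector_mul_lid
      matrix_vector_mult_0_right)

lemma hom_coords_moebius_map:
  assumes "det A \<noteq> 0"
  obtains c where "c \<noteq> 0" "A *v hom_coords p = c *s hom_coords (moebius_map A p)"
  using hom_coords_sphere_point[OF mult_vector_nonzero[OF assms hom_coords_nonzero]] moebius_map_eq_sphere_point by metis

text \<open>The hypothesis keeps \<open>B *v hom_coords p\<close> nonzero, so that it is a nonzero
  multiple of coordinates of the image point; such a factor does not change the point reached by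
  \<open>A\<close>.\<close>

lemma moebius_map_mult:
  assumes "det B \<noteq> 0"
  shows "moebius_map (A ** B) = moebius_map A \<circ> moebius_map B"
proof
  fix p
  obtain c where c: "c \<noteq> 0" "B *v hom_coords p = c *s hom_coords (moebius_map B p)"
    by (rule hom_coords_moebius_map[OF assms])
  have "(A ** B) *v hom_coords p = c *s (A *v hom_coords (moebius_map B p))"
    by (simp add: matrix_vector_mul_assoc[symmetric] c vec.scale)
  then show "moebius_map (A ** B) p = (moebius_map A \<circ> moebius_map B) p"
    by (simp add: moebius_map_eq_sphere_point[of "A ** B"] moebius_map_eq_sphere_point[of A] sphere_point_smult c)
qed

lemma moebius_map_scalar: "\<alpha> \<noteq> 0 \<Longrightarrow> moebius_map (mat \<alpha>) = id"
  by (rule ext) (simp add: moebius_map_def split: option.split)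

text \<open>Three fixed points suffice: infinity and 0 kill the off-diagonal entries, and 1 equates
  the diagonal ones.\<close>

lemma moebius_map_eq_id_imp_scalar:
  assumes "det A \<noteq> 0" "moebius_map A = id"
  shows "scalar_matrix A"
proof -
  have "moebius_map A None = None" "moebius_map A (Some 0) = Some 0" "moebius_map A (Some 1) = Some 1"
    using assms by simp_all
  then have "A$2$1 = 0" "A$1$2 = 0" "A$1$1 = A$2$2"
    using assms(1) by (auto simp: moebius_map_def det_2 split: if_splits)
  then have "A = mat (A$1$1)"
    by (simp add: matrix_eq_2)
  then show ?thesis
    unfolding scalar_matrix_def by blast
qed

lemma map_option_cnj_moebius_map:
  "map_option cnj (moebius_map A p) = moebius_map (map_matrix cnj A) (map_option cnj p)"
  by (cases p) (simp_all add: moebius_map_def flip: complex_cnj_mult complex_cnj_add)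

lemma det_map_cnj: "det (map_matrix cnj A) = cnj (det A)" for A :: "complex^2^2"
  by (simp add: det_2)

text \<open>Moving a conjugation past a Moebius map conjugates its matrix, and then the two
  conjugations cancel.\<close>

lemma anti_moebius_map_comp_self:
  assumes "det A \<noteq> 0"
  shows "anti_moebius_map A \<circ> anti_moebius_map A = moebius_map (A ** map_matrix cnj A)"
proof -
  have "det (map_matrix cnj A) \<noteq> 0"
    using assms by (simp add: det_map_cnj)
  then show ?thesis
    by (auto simp: fun_eq_iff anti_moebius_map_def moebius_map_mult map_option_cnj_moebius_map
        option.map_comp comp_def option.map_ident)
qed

section \<open>Normal forms and the trace invariant\<close>

text \<open>The columns of \<open>P\<close> are the basis in which \<open>A\<close> becomes
  \<open>D\<close>; the conjugating map is given by the inverse of \<open>P\<close>.\<close>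

lemma moebius_conjugateI:
  assumes "A ** P = P ** D" "det P \<noteq> 0" "det D \<noteq> 0"
  shows "moebius_conjugate (moebius_map A) (moebius_map D)"
proof -
  obtain M where M: "P ** M = mat 1" "M ** P = mat 1" "det M \<noteq> 0"
    using inverse_of_det_nonzero assms(2) by blast
  have "M ** A = M ** (A ** P) ** M"
    by (simp add: matrix_mul_assoc[symmetric] M)
  also have "\<dots> = D ** M"
    by (simp add: assms(1) matrix_mul_assoc M)
  finally have eq: "M ** A = D ** M" .
  have "det A \<noteq> 0"
    using assms by (metis det_mul mult_eq_0_iff)
  then have "moebius_map M \<circ> moebius_map A = moebius_map D \<circ> moebius_map M"
    using eq M(3) by (metis moebius_map_mult)
  then show ?thesis
    using M(3) unfolding moebius_conjugate_def by blast
qed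

lemma moebius_map_eq_imp_multiple:
  assumes "det A \<noteq> 0" "det B \<noteq> 0" "moebius_map A = moebius_map B"
  obtains \<alpha> where "\<alpha> \<noteq> 0" "A = B ** mat \<alpha>"
proof -
  obtain C where C: "B ** C = mat 1" "C ** B = mat 1" "det C \<noteq> 0"
    using inverse_of_det_nonzero assms(2) by blast
  have "moebius_map (C ** A) = moebius_map (C ** B)"
    using assms by (simp add: moebius_map_mult)
  then have "moebius_map (C ** A) = id"
    by (simp add: C moebius_map_scalar)
  moreover have "det (C ** A) \<noteq> 0"
    using C assms by (simp add: det_mul)
  ultimately obtain \<alpha> where \<alpha>: "C ** A = mat \<alpha>"
    using moebius_map_eq_id_imp_scalar scalar_matrix_def by blast
  then have "A = B ** mat \<alpha>"
    by (metis C(1) matrix_mul_assoc matrix_mul_lid)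
  moreover have "\<alpha> \<noteq> 0"
    using \<open>det (C ** A) \<noteq> 0\<close> \<alpha> by (auto simp: det_2)
  ultimately show ?thesis
    using that by blast
qed

text \<open>Equality of the maps determines the matrices only up to a factor \<alpha>. It multiplies
  both the squared trace and the determinant by \<alpha>^2, so it drops out of the quotient.\<close>

lemma tr_inv_similar:
  assumes "det A \<noteq> 0" "det D \<noteq> 0" "moebius_conjugate (moebius_map A) (moebius_map D)"
  shows "tr_inv A = tr_inv D"
proof -
  obtain M where M: "det M \<noteq> 0" "moebius_map M \<circ> moebius_map A = moebius_map D \<circ> moebius_map M"
    using assms(3) unfolding moebius_conjugate_def by blast
  then have "moebius_map (M ** A) = moebius_map (D ** M)"
    using assms by (simp add: moebius_map_mult)
  then obtain \<alpha> where \<alpha>: "\<alpha> \<noteq> 0" "M ** A = D ** M ** mat \<alpha>"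
    using moebius_map_eq_imp_multiple[of "M ** A" "D ** M"] assms M(1) by (auto simp: det_mul)
  obtain N where N: "M ** N = mat 1" "N ** M = mat 1"
    using inverse_of_det_nonzero M(1) by blast
  have "A = (N ** (D ** M)) ** mat \<alpha>"
    by (metis N(2) \<alpha>(2) matrix_mul_assoc matrix_mul_lid)
  then have "det A = det N * det D * det M * \<alpha>\<^sup>2" "trace A = trace (N ** (D ** M)) * \<alpha>"
    by (simp_all add: det_mul) (simp_all add: det_2 power2_eq_square trace_2 matrix_mult_2_nth algebra_simps)
  moreover have "trace (N ** (D ** M)) = trace D"
    by (metis N(1) matrix_mul_assoc matrix_mul_rid trace_mul_sym)
  moreover have "det N * det M = 1"
    by (metis N(2) det_I det_mul)
  ultimately have "det A = det D * \<alpha>\<^sup>2" "trace A = trace D * \<alpha>"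
    by (simp_all add: algebra_simps)
  then show ?thesis
    using \<alpha>(1) by (simp add: tr_inv_def power_mult_distrib)
qed

section \<open>Diagonal and Jordan forms of 2 x 2 matrices\<close>

definition diag2 :: "complex \<Rightarrow> complex \<Rightarrow> complex^2^2" where
  "diag2 x y = vector [vector [x, 0], vector [0, y]]"

lemma diag2_nth [simp]:
  "diag2 x y $ 1 $ 1 = x" "diag2 x y $ 1 $ 2 = 0" "diag2 x y $ 2 $ 1 = 0" "diag2 x y $ 2 $ 2 = y"
  by (simp_all add: diag2_def)

lemma det_diag2 [simp]: "det (diag2 x y) = x * y"
  by (simp add: det_2)

lemma moebius_map_diag2:
  "y \<noteq> 0 \<Longrightarrow> moebius_map (diag2 x y) = map_option (\<lambda>w. x / y * w)"
  by (rule ext) (simp add: moebius_map_def split: option.split)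

lemma diagonalization_2:
  fixes A :: "complex^2^2"
  assumes "(trace A)\<^sup>2 \<noteq> 4 * det A"
  obtains P x y where "det P \<noteq> 0" "A ** P = P ** diag2 x y"
proof -
  define a b c d where abcd: "a = A$1$1" "b = A$1$2" "c = A$2$1" "d = A$2$2"
  show ?thesis
  proof (cases "c = 0")
    case True
    \<comment> \<open>The columns are eigenvectors of the upper triangular matrix for the
      eigenvalues \<open>a\<close> and \<open>d\<close>.\<close>
    define P :: "complex^2^2" where "P = vector [vector [1, b], vector [0, d - a]]"
    have "a \<noteq> d"
      using assms True by (auto simp: trace_2 det_2 power2_eq_square simp flip: abcd)
    then have "det P \<noteq> 0"
      by (simp add: P_def det_2)
    moreover have "A ** P = P ** diag2 a d"
      using True by (simp add: matrix_eq_2 matrix_mult_2_nth P_def algebra_simps flip: abcd)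
    ultimately show ?thesis
      by (rule that)
  next
    case False
    define r where "r = csqrt ((a + d)\<^sup>2 - 4 * (a * d - b * c))"
    have r2: "r\<^sup>2 = (a + d)\<^sup>2 - 4 * (a * d - b * c)"
      by (simp add: r_def)
    have r0: "r \<noteq> 0"
      using assms r2 by (auto simp: trace_2 det_2 simp flip: abcd)
    define x y where xy: "x = (a + d + r) / 2" "y = (a + d - r) / 2"
    \<comment> \<open>The second row of the eigenvalue equation for \<open>x\<close> is solved by
      \<open>(x - d, c)\<close>, and likewise for \<open>y\<close>; the first row is the
      characteristic equation.\<close>
    define P :: "complex^2^2" where "P = vector [vector [x - d, y - d], vector [c, c]]"
    have "det P = c * r"
      by (simp add: P_def det_2 xy field_simps)
    then have "det P \<noteq> 0"
      using False r0 by simp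
    moreover have "a * (x - d) + b * c = x * (x - d)" "a * (y - d) + b * c = y * (y - d)"
      using r2 unfolding xy by (simp_all add: field_simps power2_eq_square) algebra+
    then have "A ** P = P ** diag2 x y"
      by (simp add: matrix_eq_2 matrix_mult_2_nth P_def algebra_simps flip: abcd)
    ultimately show ?thesis
      by (rule that)
  qed
qed

text \<open>Write \<open>A\<close> as \<open>x\<close> plus a trace-free matrix N with entries n, b,
  c, -n. The discriminant condition says that N^2 = 0, and a Jordan basis is N w, w for a standard
  basis vector w not killed by N.\<close>

lemma jordan_form_2:
  fixes A :: "complex^2^2"
  assumes "(trace A)\<^sup>2 = 4 * det A" "\<not> scalar_matrix A"
  obtains P x where "det P \<noteq> 0" "A ** P = P ** vector [vector [x, 1], vector [0, x]]" "2 * x = trace A"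
proof -
  define a b c d where abcd: "a = A$1$1" "b = A$1$2" "c = A$2$1" "d = A$2$2"
  define x n where xn: "x = (a + d) / 2" "n = (a - d) / 2"
  have adx: "a = x + n" "d = x - n"
    by (simp_all add: xn field_simps)
  have n2: "n\<^sup>2 = - b * c"
  proof -
    have "4 * n\<^sup>2 + 4 * b * c = (a + d)\<^sup>2 - 4 * (a * d - b * c)"
      by (simp add: xn field_simps power2_eq_square)
    also have "\<dots> = 0"
      using assms(1) by (simp add: trace_2 det_2 flip: abcd)
    finally have "4 * (n\<^sup>2 + b * c) = 0"
      by (simp add: algebra_simps)
    then show ?thesis
      by (simp add: add_eq_0_iff2)
  qed
  have x2: "2 * x = trace A"
    by (simp add: xn trace_2 abcd)
  show ?thesis
  proof (cases "c = 0")
    case True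
    then have "n = 0"
      using n2 by simp
    have "b \<noteq> 0"
    proof
      assume "b = 0"
      then have "A = mat x"
        using True \<open>n = 0\<close> by (simp add: matrix_eq_2 adx flip: abcd)
      then show False
        using assms(2) scalar_matrix_def by blast
    qed
    define P :: "complex^2^2" where "P = vector [vector [b, 0], vector [0, 1]]"
    have "det P \<noteq> 0"
      using \<open>b \<noteq> 0\<close> by (simp add: P_def det_2)
    moreover have "A ** P = P ** vector [vector [x, 1], vector [0, x]]"
      using True \<open>n = 0\<close> by (simp add: matrix_eq_2 matrix_mult_2_nth P_def adx flip: abcd)
    ultimately show ?thesis
      using that x2 by blast
  next
    case False
    define P :: "complex^2^2" where "P = vector [vector [n, 1], vector [c, 0]]"
    have "det P \<noteq> 0"
      using False by (simp add: P_def det_2)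
    moreover have "A ** P = P ** vector [vector [x, 1], vector [0, x]]"
      using n2 by (simp add: matrix_eq_2 matrix_mult_2_nth P_def adx power2_eq_square algebra_simps
          flip: abcd)
    ultimately show ?thesis
      using that x2 by blast
  qed
qed

lemma tr_inv_diagonalized:
  assumes "det P \<noteq> 0" "A ** P = P ** diag2 x y" "det A \<noteq> 0"
  shows "x \<noteq> 0" "y \<noteq> 0" "moebius_conjugate (moebius_map A) (map_option (\<lambda>w. x / y * w))"
    "tr_inv A = x / y + y / x + 2"
proof -
  have "det A * det P = det P * (x * y)"
    using assms(2) by (metis det_diag2 det_mul)
  then show xy: "x \<noteq> 0" "y \<noteq> 0"
    using assms by auto
  then have "moebius_conjugate (moebius_map A) (moebius_map (diag2 x y))"
    using assms by (intro moebius_conjugateI[OF assms(2,1)]) simp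
  then show "moebius_conjugate (moebius_map A) (map_option (\<lambda>w. x / y * w))"
    and "tr_inv A = x / y + y / x + 2"
    using tr_inv_similar[of A "diag2 x y"] assms xy
    by (simp_all add: moebius_map_diag2 tr_inv_def trace_2 field_simps power2_eq_square)
qed

text \<open>Equality of z + 1/z with its conjugate factors as (z - cnj z) (z cnj z - 1) = 0. For the
  multiplier z = x / y this separates stretches from rotations.\<close>

lemma real_or_unit_if_sum_inverse_real:
  assumes "z \<noteq> 0" "z + inverse z \<in> \<real>"
  shows "z \<in> \<real> \<or> cmod z = 1"
proof -
  have "z + inverse z = cnj z + inverse (cnj z)"
    using assms(2) by (metis Reals_cnj_iff complex_cnj_add complex_cnj_inverse)
  then have "(z - cnj z) * (z * cnj z - 1) = 0"
    using assms(1) by (simp add: field_simps)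
  then have "z = cnj z \<or> z * cnj z = 1"
    by auto
  moreover have "cmod z = 1" if "z * cnj z = 1"
  proof -
    have "(cmod z)\<^sup>2 = 1"
      using that complex_norm_square[of z] by (metis of_real_1 of_real_eq_iff)
    then show ?thesis
      using norm_ge_zero[of z] by (auto simp: power2_eq_1_iff)
  qed
  ultimately show ?thesis
    by (metis Reals_cnj_iff)
qed

lemma tr_inv_eq_4_iff: "det A \<noteq> 0 \<Longrightarrow> tr_inv A = 4 \<longleftrightarrow> (trace A)\<^sup>2 = 4 * det A"
  by (simp add: tr_inv_def field_simps)

section \<open>Normal forms read off from the value of the invariant\<close>

lemma cmod_of_real_minus_2: "cmod (complex_of_real t - 2) = \<bar>t - 2\<bar>"
  by (metis norm_of_real of_real_diff of_real_numeral)

theorem stretch_or_stretch_half_turn: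
  assumes det: "det A \<noteq> 0" and t: "tr_inv A = complex_of_real t" and "t < 0 \<or> t > 4"
  shows "(t > 0 \<and> stretch (moebius_map A)) \<or> (t < 0 \<and> stretch_half_turn (moebius_map A))"
proof -
  have "tr_inv A \<noteq> 4"
  proof
    assume "tr_inv A = 4"
    then have "complex_of_real t = complex_of_real 4"
      using t by simp
    then show False
      using assms(3) of_real_eq_iff[of t 4] by auto
  qed
  then obtain P x y where P: "det P \<noteq> 0" "A ** P = P ** diag2 x y"
    using diagonalization_2 tr_inv_eq_4_iff[OF det] by metis
  note n = tr_inv_diagonalized[OF P det]
  define z where "z = x / y"
  have z: "z \<noteq> 0" "complex_of_real t = z + inverse z + 2"
    using n t by (auto simp: z_def)
  then have "z + inverse z = complex_of_real (t - 2)"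
    by (simp add: algebra_simps)
  then have "z + inverse z \<in> \<real>"
    by (metis Reals_of_real)
  \<comment> \<open>A multiplier of modulus 1 would give |t - 2| = |z + 1/z| \<le> 2.\<close>
  moreover have "cmod z \<noteq> 1"
  proof
    assume u: "cmod z = 1"
    have "\<bar>t - 2\<bar> = cmod (z + inverse z)"
      using \<open>z + inverse z = complex_of_real (t - 2)\<close> by (metis norm_of_real)
    also have "\<dots> \<le> 2"
      using norm_triangle_ineq[of z "inverse z"] u by (simp add: norm_inverse)
    finally show False
      using assms(3) by auto
  qed
  ultimately obtain \<kappa> where \<kappa>: "z = complex_of_real \<kappa>"
    using real_or_unit_if_sum_inverse_real z(1) Reals_cases by metis
  have "complex_of_real t = complex_of_real (\<kappa> + inverse \<kappa> + 2)"
    using z(2) \<kappa> by simp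
  then have t\<kappa>: "t = \<kappa> + inverse \<kappa> + 2"
    using of_real_eq_iff by blast
  have "\<kappa> \<noteq> 0" "\<kappa> \<noteq> 1" "\<kappa> \<noteq> - 1"
    using z(1) assms(3) t\<kappa> \<kappa> by auto
  \<comment> \<open>In this form the sign of the multiplier \<kappa> is visibly the sign of
    \<open>t\<close>.\<close>
  have "t = (\<kappa> + 1)\<^sup>2 / \<kappa>"
    using t\<kappa> \<open>\<kappa> \<noteq> 0\<close> by (simp add: field_simps power2_eq_square)
  moreover have "(\<kappa> + 1)\<^sup>2 > 0"
    using \<open>\<kappa> \<noteq> - 1\<close> by (simp add: add_eq_0_iff)
  ultimately have "t > 0 \<longleftrightarrow> \<kappa> > 0" "t < 0 \<longleftrightarrow> \<kappa> < 0"
    using \<open>\<kappa> \<noteq> 0\<close> by (auto simp: zero_less_divide_iff divide_less_0_iff)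
  moreover have "moebius_conjugate (moebius_map A) (map_option (\<lambda>w. complex_of_real \<kappa> * w))"
    using n(3) by (simp add: \<kappa>[symmetric] z_def)
  ultimately show ?thesis
    using assms(3) \<open>\<kappa> \<noteq> 1\<close> \<open>\<kappa> \<noteq> - 1\<close> unfolding stretch_def stretch_half_turn_def
    by (metis linorder_neqE_linordered_idom order_less_irrefl order_less_trans zero_less_numeral)
qed

theorem half_turn_if_tr_inv_0:
  assumes det: "det A \<noteq> 0" and t: "tr_inv A = 0"
  shows "half_turn (moebius_map A)"
proof -
  have "tr_inv A \<noteq> 4"
    using t by simp
  then obtain P x y where P: "det P \<noteq> 0" "A ** P = P ** diag2 x y"
    using diagonalization_2 tr_inv_eq_4_iff[OF det] by metis
  note n = tr_inv_diagonalized[OF P det]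
  have "(x + y)\<^sup>2 = 0"
    using n(1,2,4) t by (simp add: field_simps power2_eq_square)
  then have "x / y = - 1"
    using n(2) by (simp add: field_simps add_eq_0_iff)
  then show ?thesis
    using n(3) unfolding half_turn_def by simp
qed

theorem translation_if_tr_inv_4:
  assumes det: "det A \<noteq> 0" and t: "tr_inv A = 4" and "\<not> scalar_matrix A"
  shows "translation (moebius_map A)"
proof -
  have t4: "(trace A)\<^sup>2 = 4 * det A"
    using t tr_inv_eq_4_iff[OF det] by blast
  obtain P x where P: "det P \<noteq> 0" "A ** P = P ** vector [vector [x, 1], vector [0, x]]"
      "2 * x = trace A"
    by (rule jordan_form_2[OF t4 assms(3)])
  let ?J = "vector [vector [x, 1], vector [0, x]] :: complex^2^2"
  have "x \<noteq> 0"
    using P(3) t4 det by auto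
  then have "moebius_conjugate (moebius_map A) (moebius_map ?J)"
    by (intro moebius_conjugateI[OF P(2) P(1)]) (simp add: det_2)
  moreover have "moebius_map ?J = map_option (\<lambda>w. w + inverse x)"
    using \<open>x \<noteq> 0\<close> by (auto simp: fun_eq_iff moebius_map_def field_simps split: option.split)
  ultimately show ?thesis
    using \<open>x \<noteq> 0\<close> unfolding translation_def by (metis inverse_nonzero_iff_nonzero)
qed

text \<open>The invariant of w \<mapsto> \<kappa> w with real \<kappa> is (\<kappa> + 1)^2 /
  \<kappa>, which is real.\<close>

theorem not_stretch_half_turn:
  assumes det: "det A \<noteq> 0" and t: "tr_inv A \<notin> \<real>"
  shows "\<not> stretch_half_turn (moebius_map A)"
proof
  assume "stretch_half_turn (moebius_map A)"
  then obtain \<kappa> :: real where \<kappa>: "\<kappa> < 0"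
      "moebius_conjugate (moebius_map A) (map_option (\<lambda>w. complex_of_real \<kappa> * w))"
    unfolding stretch_half_turn_def by blast
  then have "moebius_conjugate (moebius_map A) (moebius_map (diag2 (complex_of_real \<kappa>) 1))"
    by (simp add: moebius_map_diag2)
  then have "tr_inv A = tr_inv (diag2 (complex_of_real \<kappa>) 1)"
    using det \<kappa>(1) by (intro tr_inv_similar) auto
  also have "\<dots> = complex_of_real ((\<kappa> + 1)\<^sup>2 / \<kappa>)"
    by (simp add: tr_inv_def trace_2)
  finally show False
    using t by simp
qed

section \<open>The linear action on Hermitian matrices\<close>

definition herm :: "real^4 \<Rightarrow> complex^2^2" where
  "herm v = vector [vector [complex_of_real (v$1 + v$4), Complex (v$2) (v$3)],
                    vector [Complex (v$2) (- v$3), complex_of_real (v$1 - v$4)]]"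

text \<open>A real-linear left inverse of \<open>herm\<close> that is total; it is a two-sided
  inverse only on Hermitian matrices, as in \<open>herm_unherm\<close>.\<close>

definition unherm :: "complex^2^2 \<Rightarrow> real^4" where
  "unherm X = vector [(Re (X$1$1) + Re (X$2$2)) / 2, Re (X$1$2), Im (X$1$2),
                      (Re (X$1$1) - Re (X$2$2)) / 2]"

definition ctrans :: "complex^2^2 \<Rightarrow> complex^2^2" where
  "ctrans A = map_matrix cnj (transpose A)"

text \<open>The division restores the determinant of the Hermitian matrix, and it makes nonzero
  multiples of \<open>A\<close> act alike.\<close>

definition lorentz :: "complex^2^2 \<Rightarrow> real^4 \<Rightarrow> real^4" where
  "lorentz A v = unherm (A ** herm v ** ctrans A) /\<^sub>R cmod (det A)"

text \<open>On Hermitian matrices this is entrywise conjugation, or equally transposition.\<close>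

definition vconj :: "real^4 \<Rightarrow> real^4" where
  "vconj v = vector [v$1, v$2, - v$3, v$4]"

text \<open>The cone over \<open>H3\<close>, corresponding to the positive definite matrices. Unlike
  \<open>H3\<close> it is closed under addition, so fixed vectors can be built as sums.\<close>

definition forward_cone :: "(real^4) set" where
  "forward_cone = {v. Q v > 0 \<and> v$1 > 0}"

lemma vec_eq_4: "v = w \<longleftrightarrow> v$1 = w$1 \<and> v$2 = w$2 \<and> v$3 = w$3 \<and> v$4 = w$4" for v w :: "'a^4"
  by (simp add: vec_eq_iff forall_4)

lemma herm_nth [simp]:
  "herm v $ 1 $ 1 = complex_of_real (v$1 + v$4)" "herm v $ 1 $ 2 = Complex (v$2) (v$3)"
  "herm v $ 2 $ 1 = Complex (v$2) (- v$3)" "herm v $ 2 $ 2 = complex_of_real (v$1 - v$4)"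
  by (simp_all add: herm_def)

lemma ctrans_nth [simp]: "ctrans A $ i $ j = cnj (A $ j $ i)"
  by (simp add: ctrans_def transpose_def)

lemma ctrans_mult: "ctrans (A ** B) = ctrans B ** ctrans A"
  by (simp add: matrix_eq_2 matrix_mult_2_nth mult.commute)

lemma ctrans_ctrans [simp]: "ctrans (ctrans A) = A"
  by (simp add: matrix_eq_2)

lemma det_ctrans: "det (ctrans A) = cnj (det A)"
  by (simp add: det_2)

lemma ctrans_herm [simp]: "ctrans (herm v) = herm v"
  by (simp add: matrix_eq_2 complex_eq_iff)

lemma herm_unherm:
  assumes "ctrans X = X"
  shows "herm (unherm X) = X"
proof -
  have "X$1$1 = cnj (X$1$1)" "X$2$1 = cnj (X$1$2)" "X$2$2 = cnj (X$2$2)"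
    using assms by (metis ctrans_nth)+
  then show ?thesis
    by (simp add: matrix_eq_2 unherm_def complex_eq_iff field_simps)
qed

lemma unherm_herm [simp]: "unherm (herm v) = v"
  by (simp add: vec_eq_4 unherm_def field_simps)

lemma herm_inject: "herm v = herm w \<longleftrightarrow> v = w"
  by (metis unherm_herm)

lemma linear_herm: "linear herm"
  by (rule linearI) (simp_all add: matrix_eq_2 complex_eq_iff algebra_simps)

lemma linear_unherm: "linear unherm"
  by (rule linearI) (simp_all add: vec_eq_4 unherm_def field_simps)

lemma herm_lorentz: "herm (lorentz A v) = (A ** herm v ** ctrans A) /\<^sub>R cmod (det A)"
proof -
  have "ctrans (A ** herm v ** ctrans A) = A ** herm v ** ctrans A"
    by (simp add: ctrans_mult matrix_mul_assoc)
  then show ?thesis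
    by (simp add: lorentz_def linear_scale[OF linear_herm] herm_unherm)
qed

lemma Q_eq_det_herm: "complex_of_real (Q v) = det (herm v)"
  by (simp add: Q_def det_2 complex_eq_iff algebra_simps power2_eq_square)

lemma det_scaleR_2: "det (r *\<^sub>R X) = complex_of_real (r\<^sup>2) * det X" for X :: "complex^2^2"
  by (simp add: det_2) (simp add: scaleR_conv_of_real algebra_simps power2_eq_square)

lemma Q_lorentz:
  assumes "det A \<noteq> 0"
  shows "Q (lorentz A v) = Q v"
proof -
  have "complex_of_real (Q (lorentz A v)) = complex_of_real (Q v)"
    using assms
    by (simp add: Q_eq_det_herm herm_lorentz det_scaleR_2 det_mul det_ctrans field_simps
        complex_norm_square[symmetric])
  then show ?thesis
    using of_real_eq_iff by blast
qed

lemma lorentz_mult: "lorentz (A ** B) v = lorentz A (lorentz B v)"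
proof -
  have "herm (lorentz (A ** B) v) = herm (lorentz A (lorentz B v))"
    by (simp add: herm_lorentz ctrans_mult det_mul norm_mult matrix_mul_assoc matrix_scalar_ac
        scalar_matrix_assoc[symmetric] mult.commute)
  then show ?thesis
    by (simp add: herm_inject)
qed

lemma lorentz_mat_1 [simp]: "lorentz (mat 1) v = v"
proof -
  have "ctrans (mat 1) = mat 1"
    by (simp add: matrix_eq_2)
  then show ?thesis
    by (simp add: lorentz_def)
qed

lemma matrix_add_rdistrib: "(A + B) ** C = A ** C + B ** C" for A :: "'a::semiring_1^'n^'m"
  by (simp add: vec_eq_iff matrix_matrix_mult_def sum.distrib distrib_right)

lemma linear_lorentz: "linear (lorentz A)"
proof (rule linearI)
  show "lorentz A (v + w) = lorentz A v + lorentz A w" for v w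
    by (simp add: lorentz_def linear_add[OF linear_herm] matrix_add_ldistrib matrix_add_rdistrib
        linear_add[OF linear_unherm] scaleR_right_distrib)
  show "lorentz A (r *\<^sub>R v) = r *\<^sub>R lorentz A v" for r v
    by (simp add: lorentz_def linear_scale[OF linear_herm] matrix_scalar_ac
        scalar_matrix_assoc[symmetric] linear_scale[OF linear_unherm])
qed

text \<open>A Hermitian matrix with positive determinant and positive trace is positive definite.\<close>

lemma herm_pos:
  assumes "v \<in> forward_cone"
  defines "x \<equiv> v$1 + v$4" and "y \<equiv> v$1 - v$4" and "z \<equiv> Complex (v$2) (v$3)"
  shows "Re (a * x * cnj a + a * z * cnj b + b * cnj z * cnj a + b * y * cnj b) \<ge> 0"
proof -
  have xy: "x * y > (v$2)\<^sup>2 + (v$3)\<^sup>2" "x + y > 0"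
    using assms(1) by (simp_all add: forward_cone_def x_def y_def Q_def power2_eq_square algebra_simps)
  then have "x * y > 0"
    using zero_le_power2[of "v$2"] zero_le_power2[of "v$3"] by linarith
  then have "x > 0"
    using xy(2) by (auto simp: zero_less_mult_iff)
  let ?e = "Re (a * x * cnj a + a * z * cnj b + b * cnj z * cnj a + b * y * cnj b)"
  \<comment> \<open>Completing the square in the Hermitian form.\<close>
  have "x * ?e = (cmod (a * x + b * cnj z))\<^sup>2 + (cmod b)\<^sup>2 * (x * y - ((v$2)\<^sup>2 + (v$3)\<^sup>2))"
    unfolding z_def cmod_power2 by (simp add: power2_eq_square algebra_simps)
  also have "\<dots> \<ge> 0"
    using xy(1) by (intro add_nonneg_nonneg mult_nonneg_nonneg) simp_all
  finally show ?thesis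
    using \<open>x > 0\<close> by (simp add: zero_le_mult_iff)
qed

text \<open>The weak inequality is what positivity of the Hermitian form yields; strictness follows
  because \<open>Q\<close> is at most 0 where the first coordinate vanishes.\<close>

lemma forward_coneI:
  assumes "Q v > 0" "v$1 \<ge> 0"
  shows "v \<in> forward_cone"
proof -
  have "v$1 \<noteq> 0"
  proof
    assume "v$1 = 0"
    then have "Q v = - ((v$2)\<^sup>2 + (v$3)\<^sup>2 + (v$4)\<^sup>2)"
      by (simp add: Q_def)
    also have "\<dots> \<le> 0"
      using zero_le_power2[of "v$2"] zero_le_power2[of "v$3"] zero_le_power2[of "v$4"] by linarith
    finally show False
      using assms(1) by simp
  qed
  then show ?thesis
    using assms by (simp add: forward_cone_def)
qed

lemma lorentz_forward_cone:
  assumes "det A \<noteq> 0" "v \<in> forward_cone"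
  shows "lorentz A v \<in> forward_cone"
proof (rule forward_coneI)
  show "Q (lorentz A v) > 0"
    using assms by (simp add: Q_lorentz forward_cone_def)
  \<comment> \<open>This diagonal entry is the Hermitian form of \<open>herm v\<close> at the i-th
    row of \<open>A\<close>.\<close>
  have "Re ((A ** herm v ** ctrans A) $ i $ i) \<ge> 0" for i
    using herm_pos[OF assms(2), of "A$i$1" "A$i$2"]
    by (simp add: matrix_mult_2_nth algebra_simps complex_cnj_add)
  then show "lorentz A v $ 1 \<ge> 0"
    by (simp add: lorentz_def unherm_def)
qed

lemma vconj_nth [simp]:
  "vconj v $ 1 = v$1" "vconj v $ 2 = v$2" "vconj v $ 3 = - v$3" "vconj v $ 4 = v$4"
  by (simp_all add: vconj_def)

lemma vconj_vconj [simp]: "vconj (vconj v) = v"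
  by (simp add: vec_eq_4)

lemma linear_vconj: "linear vconj"
  by (rule linearI) (simp_all add: vec_eq_4)

lemma Q_vconj [simp]: "Q (vconj v) = Q v"
  by (simp add: Q_def)

lemma vconj_forward_cone [simp]: "vconj v \<in> forward_cone \<longleftrightarrow> v \<in> forward_cone"
  by (simp add: forward_cone_def)

text \<open>The cross term of \<open>Q (v + w)\<close> is nonnegative by the Cauchy-Schwarz
  inequality for the last three coordinates.\<close>

lemma forward_cone_add:
  assumes "v \<in> forward_cone" "w \<in> forward_cone"
  shows "v + w \<in> forward_cone"
proof -
  define s where "s = v$2 * w$2 + v$3 * w$3 + v$4 * w$4"
  define p where "p = (v$2)\<^sup>2 + (v$3)\<^sup>2 + (v$4)\<^sup>2"
  define q where "q = (w$2)\<^sup>2 + (w$3)\<^sup>2 + (w$4)\<^sup>2"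
  have pos: "v$1 > 0" "w$1 > 0" "p < (v$1)\<^sup>2" "q < (w$1)\<^sup>2"
    using assms by (simp_all add: forward_cone_def p_def q_def Q_def)
  \<comment> \<open>Lagrange's identity.\<close>
  have "p * q = s\<^sup>2 + (v$2 * w$3 - v$3 * w$2)\<^sup>2 + (v$2 * w$4 - v$4 * w$2)\<^sup>2
      + (v$3 * w$4 - v$4 * w$3)\<^sup>2"
    unfolding p_def q_def s_def by algebra
  then have "s\<^sup>2 \<le> p * q"
    by simp
  also have "\<dots> \<le> (v$1)\<^sup>2 * (w$1)\<^sup>2"
    using pos by (intro mult_mono) (simp_all add: q_def)
  finally have "\<bar>s\<bar> \<le> v$1 * w$1"
    using pos by (metis abs_le_square_iff abs_of_pos mult_pos_pos power_mult_distrib)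
  moreover have "Q (v + w) = Q v + Q w + 2 * (v$1 * w$1 - s)"
    unfolding Q_def s_def vector_add_component by (simp add: power2_eq_square algebra_simps)
  ultimately have "Q (v + w) > 0"
    using assms abs_ge_self[of s] by (auto simp: forward_cone_def intro!: add_pos_nonneg)
  then show ?thesis
    using assms by (simp add: forward_cone_def)
qed

section \<open>Isometries of hyperbolic space from matrices\<close>

lemma H3_isometryI:
  assumes "linear T" "\<And>v. Q (T v) = Q v" "\<And>v. v \<in> forward_cone \<Longrightarrow> T v \<in> forward_cone"
    and "\<And>v. T (T' v) = v" "\<And>v. Q (T' v) = Q v" "\<And>v. v \<in> forward_cone \<Longrightarrow> T' v \<in> forward_cone"
  shows "H3_isometry T"
proof -
  have H3: "H3 = {v \<in> forward_cone. Q v = 1}"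
    by (auto simp: H3_def forward_cone_def)
  have "T ` H3 = H3"
  proof
    show "T ` H3 \<subseteq> H3"
      using assms(2,3) by (auto simp: H3)
    show "H3 \<subseteq> T ` H3"
      using assms(4-6) by (auto simp: H3 image_iff) metis
  qed
  then show ?thesis
    using assms(1,2) by (simp add: H3_isometry_def)
qed

lemma H3_isometry_lorentz:
  assumes "det A \<noteq> 0"
  shows "H3_isometry (lorentz A)"
proof -
  obtain A' where "A ** A' = mat 1" "det A' \<noteq> 0"
    using inverse_of_det_nonzero assms by blast
  then show ?thesis
    using assms
    by (intro H3_isometryI[of _ "lorentz A'"])
       (simp_all add: linear_lorentz Q_lorentz lorentz_forward_cone flip: lorentz_mult)
qed

lemma H3_isometry_lorentz_vconj:
  assumes "det A \<noteq> 0"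
  shows "H3_isometry (lorentz A \<circ> vconj)"
proof -
  obtain A' where "A ** A' = mat 1" "det A' \<noteq> 0"
    using inverse_of_det_nonzero assms by blast
  then show ?thesis
    using assms
    by (intro H3_isometryI[of _ "vconj \<circ> lorentz A'"])
       (simp_all add: linear_compose linear_vconj linear_lorentz Q_lorentz lorentz_forward_cone
         flip: lorentz_mult)
qed

section \<open>Action on the conformal boundary by rank one matrices\<close>

definition outer :: "complex^2 \<Rightarrow> complex^2^2" where
  "outer v = (\<chi> i j. v$i * cnj (v$j))"

lemma herm_boundary_vector: "herm (boundary_vector p) = 2 *\<^sub>R outer (hom_coords p)"
proof (cases p)
  case None
  then show ?thesis
    by (simp add: matrix_eq_2 boundary_vector_def outer_def hom_coords_def complex_eq_iff)
next
  case (Some z)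
  then show ?thesis
    by (simp add: matrix_eq_2 boundary_vector_def outer_def hom_coords_def complex_eq_iff cmod_power2)
       (simp add: power2_eq_square)
qed

lemma outer_smult: "outer (c *s v) = (cmod c)\<^sup>2 *\<^sub>R outer v"
  by (simp add: vec_eq_iff outer_def)
     (simp add: scaleR_conv_of_real complex_norm_square[symmetric] mult_ac)

lemma outer_mult: "outer (A *v v) = A ** outer v ** ctrans A"
  by (simp add: matrix_eq_2 matrix_mult_2_nth outer_def matrix_vector_mult_2_nth algebra_simps)

lemma induces_lorentz:
  assumes "det A \<noteq> 0"
  shows "induces_on_boundary (lorentz A) (moebius_map A)"
  unfolding induces_on_boundary_def
proof
  fix p
  obtain c where c: "c \<noteq> 0" "A *v hom_coords p = c *s hom_coords (moebius_map A p)"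
    by (rule hom_coords_moebius_map[OF assms])
  \<comment> \<open>The numerator comes from the factor \<open>c\<close> between homogeneous
    coordinates, the denominator from the normalization of \<open>lorentz\<close>.\<close>
  define t where "t = (cmod c)\<^sup>2 / cmod (det A)"
  have "herm (lorentz A (boundary_vector p)) = (2 / cmod (det A)) *\<^sub>R outer (A *v hom_coords p)"
    by (simp add: herm_lorentz herm_boundary_vector outer_mult matrix_scalar_ac
        scalar_matrix_assoc[symmetric] divide_inverse)
  also have "\<dots> = herm (t *\<^sub>R boundary_vector (moebius_map A p))"
    by (simp add: c outer_smult t_def herm_boundary_vector linear_scale[OF linear_herm])
  finally have "lorentz A (boundary_vector p) = t *\<^sub>R boundary_vector (moebius_map A p)"
    by (simp add: herm_inject)
  moreover have "t > 0"
    using assms c by (simp add: t_def)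
  ultimately show "\<exists>t>0. lorentz A (boundary_vector p) = t *\<^sub>R boundary_vector (moebius_map A p)"
    by blast
qed

lemma vconj_boundary_vector: "vconj (boundary_vector p) = boundary_vector (map_option cnj p)"
  by (cases p) (simp_all add: vec_eq_4 boundary_vector_def)

lemma induces_lorentz_vconj:
  assumes "det A \<noteq> 0"
  shows "induces_on_boundary (lorentz A \<circ> vconj) (anti_moebius_map A)"
  using induces_lorentz[OF assms]
  by (simp add: induces_on_boundary_def anti_moebius_map_def vconj_boundary_vector)

section \<open>Characteristic polynomials\<close>

definition cmat :: "real^4^4 \<Rightarrow> complex^4^4" where
  "cmat M = map_matrix complex_of_real M"

definition herm_coords :: "real^4 \<Rightarrow> complex^4" where
  "herm_coords v = vector [herm v $ 1 $ 1, herm v $ 1 $ 2, herm v $ 2 $ 1, herm v $ 2 $ 2]"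

text \<open>The base change, over the complex numbers, from the standard basis to the coordinates
  given by the four matrix entries.\<close>

definition coord_matrix :: "complex^4^4" where
  "coord_matrix = (\<chi> i j. herm_coords (axis j 1) $ i)"

lemma det_cmat: "det (cmat M) = complex_of_real (det M)"
  by (simp add: det_4 cmat_def)

lemma linear_herm_coords: "linear herm_coords"
  by (rule linearI)
     (simp_all add: vec_eq_4 herm_coords_def linear_add[OF linear_herm] linear_scale[OF linear_herm])

lemma det_coord_matrix: "det coord_matrix \<noteq> 0"
  by (simp add: det_4 coord_matrix_def herm_coords_def axis_def complex_eq_iff)

lemma poly_det_4: "poly (det M) x = det (map_matrix (\<lambda>p. poly p x) M)" for M :: "'a::comm_ring_1 poly^4^4"
  by (simp add: det_4)

text \<open>Over the complex numbers \<open>K\<close> is similar to the matrix of \<open>T\<close>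
  via \<open>coord_matrix\<close>, so the two have the same determinants after subtraction from
  \<open>mat x\<close>. Equality at every real \<open>x\<close> identifies the polynomials.\<close>

lemma charpoly_eqI:
  assumes "linear T" "\<And>v. herm_coords (T v) = K *v herm_coords v"
    and "\<And>x. det (mat (complex_of_real x) - K) = complex_of_real (poly p x)"
  shows "charpoly T = p"
proof -
  have "poly (charpoly T) x = poly p x" for x
  proof -
    define M where "M = mat x - matrix T"
    have "coord_matrix ** cmat (matrix T) = K ** coord_matrix"
    proof -
      have "(coord_matrix ** cmat (matrix T)) $ i $ j = (K ** coord_matrix) $ i $ j" for i j
      proof -
        have "T (axis j 1) = (\<Sum>k\<in>UNIV. (T (axis j 1) $ k) *\<^sub>R axis k 1)"
          by (simp add: vec_eq_iff axis_def if_distrib sum.delta cong: if_cong)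
        then have "herm_coords (T (axis j 1)) = herm_coords (\<Sum>k\<in>UNIV. (T (axis j 1) $ k) *\<^sub>R axis k 1)"
          by (rule arg_cong)
        also have "\<dots> = (\<Sum>k\<in>UNIV. (T (axis j 1) $ k) *\<^sub>R herm_coords (axis k 1))"
          by (simp only: linear_sum[OF linear_herm_coords] linear_scale[OF linear_herm_coords])
        finally have "herm_coords (T (axis j 1)) = (\<Sum>k\<in>UNIV. (T (axis j 1) $ k) *\<^sub>R herm_coords (axis k 1))" .
        then have "(coord_matrix ** cmat (matrix T)) $ i $ j = herm_coords (T (axis j 1)) $ i"
          by (simp add: matrix_matrix_mult_def coord_matrix_def cmat_def matrix_def
              sum_component) (simp add: scaleR_conv_of_real mult.commute)
        also have "\<dots> = (K *v herm_coords (axis j 1)) $ i"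
          by (simp add: assms(2))
        finally show ?thesis
          by (simp add: matrix_vector_mult_def matrix_matrix_mult_def coord_matrix_def)
      qed
      then show ?thesis
        by (simp add: vec_eq_iff)
    qed
    moreover have "cmat M = mat (complex_of_real x) - cmat (matrix T)"
      by (simp add: M_def cmat_def vec_eq_iff mat_def)
    moreover have "coord_matrix ** mat (complex_of_real x) = mat (complex_of_real x) ** coord_matrix"
      by (simp add: vec_eq_4 matrix_matrix_mult_def sum_4 mat_def mult.commute)
    ultimately have "coord_matrix ** cmat M = (mat (complex_of_real x) - K) ** coord_matrix"
      by (simp add: vec_eq_iff matrix_matrix_mult_def right_diff_distrib left_diff_distrib sum_subtractf)
    then have "complex_of_real (det M) = complex_of_real (poly p x)"
      using det_coord_matrix assms(3)[of x] by (metis det_cmat det_mul mult.commute mult_right_cancel)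
    then have "det M = poly p x"
      using of_real_eq_iff by blast
    moreover have "poly (charpoly T) x = det M"
      unfolding charpoly_def poly_det_4 M_def
      by (intro arg_cong[where f = det]) (simp add: vec_eq_iff mat_def)
    ultimately show ?thesis
      by simp
  qed
  then show ?thesis
    by (simp add: poly_eq_poly_eq_iff[symmetric] ext)
qed

text \<open>In coordinates \<open>x11, x12, x21, x22\<close>, this is \<open>X \<mapsto> k \<cdot> A X B\<^sup>T\<close>.\<close>

definition kron :: "complex \<Rightarrow> complex^2^2 \<Rightarrow> complex^2^2 \<Rightarrow> complex^4^4" where
  "kron k A B = map_matrix ((*) k)
    (vector [vector [A$1$1 * B$1$1, A$1$1 * B$1$2, A$1$2 * B$1$1, A$1$2 * B$1$2],
             vector [A$1$1 * B$2$1, A$1$1 * B$2$2, A$1$2 * B$2$1, A$1$2 * B$2$2],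
             vector [A$2$1 * B$1$1, A$2$1 * B$1$2, A$2$2 * B$1$1, A$2$2 * B$1$2],
             vector [A$2$1 * B$2$1, A$2$1 * B$2$2, A$2$2 * B$2$1, A$2$2 * B$2$2]])"

text \<open>Likewise \<open>X \<mapsto> k \<cdot> A X\<^sup>T B\<^sup>T\<close>.\<close>

definition anti_kron :: "complex \<Rightarrow> complex^2^2 \<Rightarrow> complex^2^2 \<Rightarrow> complex^4^4" where
  "anti_kron k A B = (\<chi> i j. kron k A B $ i $ (if j = 2 then 3 else if j = 3 then 2 else j))"

lemma herm_coords_nth [simp]:
  "herm_coords v $ 1 = herm v $ 1 $ 1" "herm_coords v $ 2 = herm v $ 1 $ 2"
  "herm_coords v $ 3 = herm v $ 2 $ 1" "herm_coords v $ 4 = herm v $ 2 $ 2"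
  by (simp_all add: herm_coords_def)

lemma matrix_vector_mult_4_nth:
  "(A *v v) $ i = A$i$1 * v$1 + A$i$2 * v$2 + A$i$3 * v$3 + A$i$4 * v$4"
  for A :: "'a::semiring_1^4^4"
  by (simp add: matrix_vector_mult_def sum_4)

text \<open>Right multiplication by \<open>ctrans A\<close>, the transpose of the conjugate, is what
  puts \<open>map_matrix cnj A\<close> in the second slot.\<close>

lemma herm_coords_lorentz: "herm_coords (lorentz A v) = kron (inverse (complex_of_real (cmod (det A)))) A (map_matrix cnj A) *v herm_coords v"
  by (simp add: vec_eq_4 matrix_vector_mult_4_nth kron_def herm_lorentz matrix_mult_2_nth
      del: herm_nth) (simp add: scaleR_conv_of_real algebra_simps)

lemma herm_coords_lorentz_vconj:
  "herm_coords ((lorentz A \<circ> vconj) v) = anti_kron (inverse (complex_of_real (cmod (det A)))) A (map_matrix cnj A) *v herm_coords v"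
  by (simp add: herm_coords_lorentz vec_eq_4 matrix_vector_mult_4_nth anti_kron_def)

lemma mat_4_nth:
  "(mat k :: 'a::zero^4^4) $ i $ j = (if i = j then k else 0)"
  by (simp add: mat_def)

text \<open>The characteristic polynomial of a multiple of the tensor product of \<open>A\<close>
  and \<open>B\<close>. Keeping \<open>B\<close> independent of \<open>A\<close> avoids conjugates
  and leaves a polynomial identity in nine entries and factors besides \<open>X\<close>.\<close>

lemma det_kron:
  "det (mat X - kron k A B) = X^4 - k * trace A * trace B * X^3
    + k\<^sup>2 * ((trace A)\<^sup>2 * det B + (trace B)\<^sup>2 * det A - 2 * det A * det B) * X\<^sup>2
    - k^3 * trace A * trace B * det A * det B * X + k^4 * (det A * det B)\<^sup>2"
proof -
  define a b c d a' b' c' d' where "a = A$1$1" "b = A$1$2" "c = A$2$1" "d = A$2$2"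
    "a' = B$1$1" "b' = B$1$2" "c' = B$2$1" "d' = B$2$2"
  note defs = this
  show ?thesis
    unfolding kron_def trace_2 det_2 det_4 vector_minus_component mat_4_nth nth_map_matrix vector_4
      defs[symmetric]
    by simp algebra
qed

text \<open>For B the conjugate of A and k = 1 / |det A|, the number k^2 det A det B is 1, so the
  first factor carries the eigenvalues 1 and -1.\<close>

lemma det_anti_kron:
  "det (mat X - anti_kron k A B)
    = (X\<^sup>2 - k\<^sup>2 * det A * det B) * (X\<^sup>2 - k * trace (A ** B) * X + k\<^sup>2 * det A * det B)"
proof -
  define a b c d a' b' c' d' where "a = A$1$1" "b = A$1$2" "c = A$2$1" "d = A$2$2"
    "a' = B$1$1" "b' = B$1$2" "c' = B$2$1" "d' = B$2$2"
  note defs = this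
  show ?thesis
    unfolding trace_2 det_2 det_4 matrix_mult_2_nth vector_minus_component mat_4_nth anti_kron_def
      vec_lambda_beta
    unfolding kron_def nth_map_matrix vector_4 defs[symmetric]
    by (simp add: kron_def flip: defs) algebra
qed

lemma trace_map_cnj: "trace (map_matrix cnj A) = cnj (trace A)" for A :: "complex^2^2"
  by (simp add: trace_2)

lemma inverse_cmod_square: "w \<noteq> 0 \<Longrightarrow> (inverse (complex_of_real (cmod w)))\<^sup>2 * w * cnj w = 1"
  by (simp add: power_inverse complex_norm_square[symmetric] mult.assoc)

theorem charpoly_lorentz:
  assumes det: "det A \<noteq> 0"
  shows "charpoly (lorentz A)
    = [:1, - cmod (tr_inv A), 2 * Re (tr_inv A) - 2, - cmod (tr_inv A), 1:]"
proof (rule charpoly_eqI[OF linear_lorentz herm_coords_lorentz])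
  fix x :: real
  define k s D where "k = inverse (complex_of_real (cmod (det A)))" "s = trace A" "D = det A"
  note defs = this
  have D: "D \<noteq> 0"
    using det defs by simp
  \<comment> \<open>With this relation all quantities become polynomials in \<open>k\<close>,
    \<open>s\<close>, \<open>D\<close> and the conjugates of \<open>s\<close> and \<open>D\<close>,
    and the coefficients can be compared algebraically.\<close>
  have k2: "k\<^sup>2 * D * cnj D = 1"
    using inverse_cmod_square[OF det] by (simp add: defs)
  have c: "tr_inv A = k\<^sup>2 * s\<^sup>2 * cnj D"
  proof -
    have "k\<^sup>2 * s\<^sup>2 * cnj D * D = s\<^sup>2"
      using k2 by algebra
    then show ?thesis
      unfolding tr_inv_def defs(2,3)[symmetric] by (metis D nonzero_mult_div_cancel_right)
  qed
  have cc: "cnj (tr_inv A) = k\<^sup>2 * (cnj s)\<^sup>2 * D"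
    unfolding c by (simp add: defs)
  have n: "complex_of_real (cmod (tr_inv A)) = k * s * cnj s"
  proof -
    have "complex_of_real (cmod (tr_inv A)) = complex_of_real ((cmod s)\<^sup>2) / complex_of_real (cmod D)"
      by (simp add: tr_inv_def norm_divide norm_power defs divide_inverse[symmetric])
    then show ?thesis
      by (simp only: complex_norm_square defs divide_inverse mult_ac)
  qed
  have r: "complex_of_real (2 * Re (tr_inv A)) = k\<^sup>2 * s\<^sup>2 * cnj D + k\<^sup>2 * (cnj s)\<^sup>2 * D"
    by (metis c cc complex_add_cnj)
  define X where "X = complex_of_real x"
  have "complex_of_real
      (poly [:1, - cmod (tr_inv A), 2 * Re (tr_inv A) - 2, - cmod (tr_inv A), 1:] x)
    = X^4 - complex_of_real (cmod (tr_inv A)) * X^3 + (complex_of_real (2 * Re (tr_inv A)) - 2) * X\<^sup>2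
      - complex_of_real (cmod (tr_inv A)) * X + 1"
    by (simp add: X_def algebra_simps eval_nat_numeral)
  also have "\<dots> = X^4 - k * s * cnj s * X^3
      + k\<^sup>2 * (s\<^sup>2 * cnj D + (cnj s)\<^sup>2 * D - 2 * D * cnj D) * X\<^sup>2
      - k^3 * s * cnj s * D * cnj D * X + k^4 * (D * cnj D)\<^sup>2"
    unfolding n r using k2 by algebra
  finally show "det (mat (complex_of_real x) - kron (inverse (complex_of_real (cmod (det A)))) A
      (map_matrix cnj A)) = complex_of_real
      (poly [:1, - cmod (tr_inv A), 2 * Re (tr_inv A) - 2, - cmod (tr_inv A), 1:] x)"
    unfolding det_kron det_map_cnj trace_map_cnj defs X_def by (rule sym)
qed

text \<open>The trace is real by \<open>trace_mult_cnj_real\<close>, so taking the real part loses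
  nothing. The sign, which the invariant of the squared map forgets, distinguishes circle inversions
  from antipodal maps.\<close>

definition anti_trace :: "complex^2^2 \<Rightarrow> real" where
  "anti_trace A = Re (trace (A ** map_matrix cnj A)) / cmod (det A)"

lemma trace_mult_cnj_real: "trace (A ** map_matrix cnj A) \<in> \<real>" for A :: "complex^2^2"
  by (simp add: complex_is_Real_iff trace_2 matrix_mult_2_nth)

theorem charpoly_lorentz_vconj:
  assumes det: "det A \<noteq> 0"
  shows "charpoly (lorentz A \<circ> vconj) = [:-1, 1:] * [:1, 1:] * [:1, - anti_trace A, 1:]"
proof (rule charpoly_eqI[OF linear_compose[OF linear_vconj linear_lorentz] herm_coords_lorentz_vconj])
  fix x :: real
  have "inverse (complex_of_real (cmod (det A))) * trace (A ** map_matrix cnj A)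
      = complex_of_real (anti_trace A)"
    using trace_mult_cnj_real[of A] by (auto simp: anti_trace_def elim!: Reals_cases simp: divide_inverse)
  then show "det (mat (complex_of_real x) - anti_kron (inverse (complex_of_real (cmod (det A)))) A (map_matrix cnj A)) = complex_of_real
      (poly ([:-1, 1:] * [:1, 1:] * [:1, - anti_trace A, 1:]) x)"
    unfolding det_anti_kron det_map_cnj inverse_cmod_square[OF det] by (simp add: algebra_simps power2_eq_square)
qed

section \<open>Rotatory types\<close>

text \<open>There are no quadratic factors here, so the rotation number comes from the eigenvalue -1
  alone.\<close>

lemma rotatory_factorization_unipotent:
  "rotatory_factorization ([:-1, 1:] ^ l * [:1, 1:] ^ m) (m div 2) m"
  unfolding rotatory_factorization_def
  by (rule exI[of _ l], rule exI[of _ 0], rule exI[of _ "\<lambda>_. 0"], rule exI[of _ "\<lambda>_. 0"]) simp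

lemma rotatory_factorization_rotation:
  assumes "\<bar>a\<bar> < 1"
  shows "rotatory_factorization ([:-1, 1:] ^ l * [:1, 1:] ^ m * [:1, - 2 * a, 1:]) (Suc (m div 2)) m"
  unfolding rotatory_factorization_def
  by (rule exI[of _ l], rule exI[of _ 1], rule exI[of _ "\<lambda>_. a"], rule exI[of _ "\<lambda>_. 1"])
     (use assms in \<open>simp add: lessThan_Suc del: mult_pCons_right mult_pCons_left\<close>)

lemma kernel_if_det_0:
  fixes M :: "'a::field^'n^'n"
  assumes "det M = 0"
  obtains v where "v \<noteq> 0" "M *v v = 0"
  using assms invertible_det_nz matrix_left_invertible_ker
  by (metis invertible_left_inverse)

lemma eigenvector_if_charpoly_root:
  assumes "linear T" "poly (charpoly T) x = 0"
  obtains v where "v \<noteq> 0" "T v = x *\<^sub>R v"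
proof -
  have "poly (charpoly T) x = det (mat x - matrix T)"
    unfolding charpoly_def poly_det_4
    by (intro arg_cong[where f = det]) (simp add: vec_eq_iff mat_def)
  then obtain v where v: "v \<noteq> 0" "(mat x - matrix T) *v v = 0"
    using kernel_if_det_0 assms(2) by metis
  have "mat x *v v = x *\<^sub>R v"
    by (simp add: vec_eq_iff matrix_vector_mult_def mat_def if_distrib if_distribR sum.delta cong: if_cong)
  then have "T v = x *\<^sub>R v"
    using v(2) assms(1) by (simp add: matrix_vector_mult_diff_rdistrib matrix_works)
  with v(1) show ?thesis
    by (rule that)
qed

text \<open>The characteristic polynomials occurring here show r and 1/r only through their sum; the
  root \<open>r\<close> then provides the eigenvector.\<close>

lemma hyperbolic_typeI:
  assumes "linear T" "r \<noteq> 0" "r \<noteq> 1" "r \<noteq> - 1" "rotatory_factorization p k m"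
    and "charpoly T = [:1, - (r + inverse r), 1:] * p"
  shows "hyperbolic_type k m T"
proof -
  have eq: "charpoly T = [:- r, 1:] * [:- inverse r, 1:] * p"
  proof -
    have "[:- r, 1:] * [:- inverse r, 1:] = [:1, - (r + inverse r), 1:]"
      using assms(2) by simp
    then show ?thesis
      by (simp only: assms(6))
  qed
  then have "poly (charpoly T) r = 0"
    by (simp only: poly_mult) simp
  then have "hyperbolic_eigenvalue T r"
    using assms(1,3,4) unfolding hyperbolic_eigenvalue_def
    by (metis eigenvector_if_charpoly_root)
  then show ?thesis
    using eq assms(5) unfolding hyperbolic_type_def by blast
qed

text \<open>\<open>r\<close> is a root of x^2 - t x + 1, whose discriminant is positive; r = 1 or r
  = -1 would force t^2 = 4.\<close>

lemma sum_inverse_solution: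
  fixes t :: real
  assumes "t\<^sup>2 > 4"
  obtains r where "r \<noteq> 0" "r \<noteq> 1" "r \<noteq> - 1" "r + inverse r = t"
proof -
  define s where "s = sqrt (t\<^sup>2 - 4)"
  define r where "r = (t + s) / 2"
  have s2: "s\<^sup>2 = t\<^sup>2 - 4"
    using assms by (simp add: s_def)
  have q: "r * r + 1 = t * r"
    using s2 by (simp add: r_def field_simps power2_eq_square)
  then have r: "r \<noteq> 0"
    by auto
  have "r + inverse r = t"
    using q r by (simp add: field_simps)
  moreover have "r \<noteq> 1" "r \<noteq> - 1"
    using calculation assms by auto
  ultimately show ?thesis
    using that r by blast
qed

text \<open>The characteristic polynomial is palindromic, hence a product of two factors x^2 - y x +
  1 with y a value of x + 1/x. The value above 2 gives the real pair r, 1/r, the one strictly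
  between -2 and 2 a rotation.\<close>

theorem rotatory_hyperbolic_if_tr_inv_not_real:
  assumes det: "det A \<noteq> 0" and c: "tr_inv A \<notin> \<real>"
  shows "rotatory_hyperbolic 1 (moebius_map A)"
proof -
  define n R where "n = cmod (tr_inv A)" "R = Re (tr_inv A)"
  have "\<bar>R\<bar> < n"
  proof -
    have "Im (tr_inv A) \<noteq> 0"
      using c complex_is_Real_iff by blast
    then have "R\<^sup>2 < n\<^sup>2"
      by (simp add: n_R_def cmod_power2)
    then show ?thesis
      by (metis abs_le_square_iff abs_of_nonneg linorder_not_less n_R_def(1) norm_ge_zero)
  qed
  text \<open>\<open>p\<close> and \<open>q\<close> are the roots of \<open>y\<^sup>2 - n y + 2 R - 4\<close>, which is negative at \<open>2\<close> and
    positive at \<open>-2\<close>.\<close>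
  define s where "s = sqrt ((n - 4)\<^sup>2 + 8 * (n - R))"
  define p q where "p = (n + s) / 2" "q = (n - s) / 2"
  have s2: "s\<^sup>2 = (n - 4)\<^sup>2 + 8 * (n - R)" "s \<ge> 0"
    using \<open>\<bar>R\<bar> < n\<close> by (simp_all add: s_def)
  \<comment> \<open>The first bound amounts to p > 2 and q < 2, the second to q > -2.\<close>
  then have "(n - 4)\<^sup>2 < s\<^sup>2" "s\<^sup>2 < (n + 4)\<^sup>2"
    using \<open>\<bar>R\<bar> < n\<close> by (simp_all add: power2_eq_square algebra_simps)
  then have "\<bar>n - 4\<bar> < s" "s < n + 4"
    using s2(2) \<open>\<bar>R\<bar> < n\<close>
    by (metis abs_le_square_iff abs_of_nonneg linorder_not_less)
       (rule power2_less_imp_less, use \<open>s\<^sup>2 < (n + 4)\<^sup>2\<close> \<open>\<bar>R\<bar> < n\<close> in auto)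
  then have pq: "p > 2" "\<bar>q / 2\<bar> < 1"
    unfolding p_q_def abs_less_iff by simp_all
  have pq': "p + q = n" "p * q = 2 * R - 4"
    using s2(1) by (simp_all add: p_q_def field_simps power2_eq_square)
  have "p\<^sup>2 > 4"
    using pq(1) power_strict_mono[of 2 p 2] by simp
  then obtain r where r: "r \<noteq> 0" "r \<noteq> 1" "r \<noteq> - 1" "r + inverse r = p"
    by (rule sum_inverse_solution)
  have "charpoly (lorentz A) = [:1, - p, 1:] * [:1, - q, 1:]"
    unfolding charpoly_lorentz[OF det] n_R_def[symmetric] using pq' by (simp add: algebra_simps)
  moreover have "rotatory_factorization [:1, - q, 1:] 1 0"
    using rotatory_factorization_rotation[OF pq(2), of 0 0] by simp
  ultimately have "hyperbolic_type 1 0 (lorentz A)"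
    using r by (intro hyperbolic_typeI[of _ r "[:1, - q, 1:]"] linear_lorentz) simp_all
  then show ?thesis
    unfolding rotatory_hyperbolic_def as_H3_isometry_def
    using H3_isometry_lorentz[OF det] induces_lorentz[OF det] even_zero by blast
qed

lemma lorentz_fixes_forward_vector:
  assumes det: "det A \<noteq> 0" and t: "tr_inv A = complex_of_real t" "0 < t" "t < 4"
  obtains v where "v \<in> forward_cone" "lorentz A v = v"
proof -
  have "tr_inv A \<noteq> 4"
  proof
    assume "tr_inv A = 4"
    then have "complex_of_real t = complex_of_real 4"
      using t by simp
    then show False
      using assms(4) of_real_eq_iff[of t 4] by auto
  qed
  then obtain P x y where P: "det P \<noteq> 0" "A ** P = P ** diag2 x y"
    using diagonalization_2 tr_inv_eq_4_iff[OF det] by metis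
  note n = tr_inv_diagonalized[OF P det]
  define z where "z = x / y"
  have z: "z \<noteq> 0" "complex_of_real t = z + inverse z + 2"
    using n t by (auto simp: z_def)
  \<comment> \<open>A real multiplier would have to be positive because t > 0 and negative because t
    < 4.\<close>
  have "z \<notin> \<real>"
  proof
    assume "z \<in> \<real>"
    then obtain \<kappa> where \<kappa>: "z = complex_of_real \<kappa>"
      by (rule Reals_cases)
    have "complex_of_real t = complex_of_real (\<kappa> + inverse \<kappa> + 2)"
      using z(2) \<kappa> by simp
    then have t\<kappa>: "t = \<kappa> + inverse \<kappa> + 2"
      using of_real_eq_iff by blast
    have "\<kappa> \<noteq> 0"
      using z \<kappa> by simp
    then have "t = (\<kappa> + 1)\<^sup>2 / \<kappa>" "t - 4 = (\<kappa> - 1)\<^sup>2 / \<kappa>"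
      using t\<kappa> by (simp_all add: field_simps power2_eq_square)
    then have "0 < (\<kappa> + 1)\<^sup>2 / \<kappa>" "(\<kappa> - 1)\<^sup>2 / \<kappa> < 0"
      using t(2,3) by simp_all
    then show False
      by (auto simp: zero_less_divide_iff divide_less_0_iff not_less[symmetric])
  qed
  moreover have "z + inverse z = complex_of_real (t - 2)"
    using z(2) by (simp add: algebra_simps)
  then have "z + inverse z \<in> \<real>"
    by (metis Reals_of_real)
  ultimately have "cmod z = 1"
    using real_or_unit_if_sum_inverse_real z(1) by blast
  then have "cmod x = cmod y"
    using n(2) by (simp add: z_def norm_divide)
  \<comment> \<open>The identity matrix, which a diagonal matrix with entries of equal modulus
    fixes; \<open>P\<close> carries it to the fixed vector of \<open>lorentz A\<close>.\<close>
  define e :: "real^4" where "e = vector [1, 0, 0, 0]"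
  have e: "e \<in> forward_cone"
    by (simp add: e_def forward_cone_def Q_def)
  have k: "inverse (complex_of_real (cmod y)) * inverse (complex_of_real (cmod y))
      * (complex_of_real (cmod y) * complex_of_real (cmod y)) = 1"
    using n(2) by (simp add: field_simps)
  have "herm (lorentz (diag2 x y) e) = herm e"
    using k \<open>cmod x = cmod y\<close> n(1,2)
    by (simp add: herm_lorentz matrix_eq_2 matrix_mult_2_nth e_def norm_mult)
       (simp add: scaleR_conv_of_real complex_norm_square[symmetric] power2_eq_square Complex_eq_0)
  then have "lorentz A (lorentz P e) = lorentz P e"
    using P(2) by (metis herm_inject lorentz_mult)
  then show ?thesis
    using that lorentz_forward_cone[OF P(1) e] by blast
qed

theorem rotatory_elliptic_if_tr_inv_small:
  assumes det: "det A \<noteq> 0" and t: "tr_inv A = complex_of_real t" "0 < t" "t < 4"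
  shows "rotatory_elliptic 1 (moebius_map A)"
proof -
  obtain v where v: "v \<in> forward_cone" "lorentz A v = v"
    by (rule lorentz_fixes_forward_vector[OF assms])
  then have "lorentz A v = 1 *\<^sub>R v \<and> Q v > 0"
    by (simp add: forward_cone_def)
  then have "elliptic (lorentz A)"
    unfolding elliptic_def by blast
  \<comment> \<open>As \<open>t\<close> is positive, the modulus and the real part of the invariant
    both equal \<open>t\<close>, and 1 becomes a double root.\<close>
  moreover have "charpoly (lorentz A) = [:-1, 1:] ^ 2 * [:1, 1:] ^ 0 * [:1, - 2 * ((t - 2) / 2), 1:]"
    unfolding charpoly_lorentz[OF det] using t by (simp add: power2_eq_square field_simps)
  moreover have "\<bar>(t - 2) / 2\<bar> < 1"
    using t by (simp add: abs_if)
  ultimately have "elliptic_type 1 0 (lorentz A)"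
    using rotatory_factorization_rotation[of "(t - 2) / 2" 2 0] by (simp add: elliptic_type_def)
  then show ?thesis
    unfolding rotatory_elliptic_def as_H3_isometry_def
    using H3_isometry_lorentz[OF det] induces_lorentz[OF det] even_zero by blast
qed

section \<open>Orientation-reversing isometries\<close>

lemma det_mult_cnj: "det (A ** map_matrix cnj A) = complex_of_real ((cmod (det A))\<^sup>2)"
  for A :: "complex^2^2"
  by (simp only: det_mul det_map_cnj complex_norm_square)

lemma trace_mult_cnj:
  assumes "det A \<noteq> 0"
  shows "trace (A ** map_matrix cnj A) = complex_of_real (anti_trace A * cmod (det A))"
  using trace_mult_cnj_real[of A] assms by (auto simp: anti_trace_def elim!: Reals_cases)

lemma tr_inv_mult_cnj:
  assumes "det A \<noteq> 0"
  shows "tr_inv (A ** map_matrix cnj A) = complex_of_real ((anti_trace A)\<^sup>2)"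
  using assms by (simp add: tr_inv_def trace_mult_cnj det_mult_cnj power_mult_distrib)

lemma vconj_lorentz: "vconj (lorentz A v) = lorentz (map_matrix cnj A) (vconj v)"
proof -
  have h: "herm (vconj w) = map_matrix cnj (herm w)" for w
    by (simp add: matrix_eq_2 complex_eq_iff)
  have "herm (vconj (lorentz A v)) = herm (lorentz (map_matrix cnj A) (vconj v))"
    by (simp add: h herm_lorentz det_map_cnj) (simp add: matrix_eq_2 matrix_mult_2_nth)
  then show ?thesis
    by (simp add: herm_inject)
qed

lemma lorentz_vconj_twice:
  "(lorentz A \<circ> vconj) ((lorentz A \<circ> vconj) v) = lorentz (A ** map_matrix cnj A) v"
  by (simp add: vconj_lorentz lorentz_mult)

lemma linear_lorentz_vconj: "linear (lorentz A \<circ> vconj)"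
  by (intro linear_compose linear_vconj linear_lorentz)

lemma elliptic_lorentz_vconj:
  assumes "det A \<noteq> 0" "v \<in> forward_cone" "lorentz (A ** map_matrix cnj A) v = v"
  shows "elliptic (lorentz A \<circ> vconj)"
proof -
  let ?T = "lorentz A \<circ> vconj"
  \<comment> \<open>\<open>?T\<close> preserves the cone and exchanges \<open>v\<close> and
    \<open>?T v\<close>.\<close>
  have "v + ?T v \<in> forward_cone"
    using assms by (intro forward_cone_add) (simp_all add: lorentz_forward_cone)
  moreover have "?T (v + ?T v) = v + ?T v"
    using assms(3) lorentz_vconj_twice[of A v] linear_add[OF linear_lorentz_vconj, of A v "?T v"]
    by simp
  ultimately have "?T (v + ?T v) = 1 *\<^sub>R (v + ?T v) \<and> Q (v + ?T v) > 0"
    by (simp add: forward_cone_def)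
  then show ?thesis
    unfolding elliptic_def by blast
qed

theorem rotatory_elliptic_inversion_if_anti_trace_small:
  assumes det: "det A \<noteq> 0" and "0 < (anti_trace A)\<^sup>2" "(anti_trace A)\<^sup>2 < 4"
  shows "rotatory_elliptic_inversion 1 (anti_moebius_map A)"
proof -
  have "det (A ** map_matrix cnj A) \<noteq> 0"
    using det by (simp add: det_mult_cnj)
  then obtain v where "v \<in> forward_cone" "lorentz (A ** map_matrix cnj A) v = v"
    using lorentz_fixes_forward_vector tr_inv_mult_cnj[OF det] assms(2,3) by metis
  then have "elliptic (lorentz A \<circ> vconj)"
    by (rule elliptic_lorentz_vconj[OF det])
  moreover have "\<bar>anti_trace A / 2\<bar> < 1"
    using assms(3) abs_square_less_1[of "anti_trace A / 2"] by (simp add: power_divide)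
  ultimately have "elliptic_type 1 1 (lorentz A \<circ> vconj)"
    using rotatory_factorization_rotation[of "anti_trace A / 2" 1 1]
    unfolding elliptic_type_def charpoly_lorentz_vconj[OF det] by simp
  then show ?thesis
    unfolding rotatory_elliptic_inversion_def as_H3_isometry_def
    using H3_isometry_lorentz_vconj[OF det] induces_lorentz_vconj[OF det] odd_one by blast
qed

text \<open>The quadratic factor has the real roots r, 1/r with sum \<open>anti_trace A\<close>;
  what remains is (x - 1) (x + 1), so m = 1 and k = 0.\<close>

theorem rotatory_hyperbolic_inversion_if_anti_trace_large:
  assumes det: "det A \<noteq> 0" and "(anti_trace A)\<^sup>2 > 4"
  shows "rotatory_hyperbolic_inversion 0 (anti_moebius_map A)"
proof -
  obtain r where r: "r \<noteq> 0" "r \<noteq> 1" "r \<noteq> - 1" "r + inverse r = anti_trace A"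
    by (rule sum_inverse_solution[OF assms(2)])
  have "rotatory_factorization ([:-1, 1:] * [:1, 1:]) 0 1"
    using rotatory_factorization_unipotent[of 1 1] by simp
  moreover have "charpoly (lorentz A \<circ> vconj) = [:1, - (r + inverse r), 1:] * ([:-1, 1:] * [:1, 1:])"
    unfolding charpoly_lorentz_vconj[OF det] r(4) by (simp only: mult_ac)
  ultimately have "hyperbolic_type 0 1 (lorentz A \<circ> vconj)"
    using hyperbolic_typeI[OF linear_lorentz_vconj r(1-3)] by blast
  then show ?thesis
    unfolding rotatory_hyperbolic_inversion_def as_H3_isometry_def
    using H3_isometry_lorentz_vconj[OF det] induces_lorentz_vconj[OF det] odd_one by blast
qed

section \<open>Parabolic inversions\<close>

text \<open>Meant for \<open>G\<close> a polynomial in \<open>T\<close>. If w is the component of v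
  in an invariant complement of the kernel of \<open>G\<close>, then G v = G w lies both in that
  complement and in the kernel, hence vanishes.\<close>

lemma semisimple_imp_ker_square:
  assumes T: "linear T" "semisimple T" and G: "linear G" "\<And>v. G (T v) = T (G v)"
    and GW: "\<And>W. subspace W \<Longrightarrow> T ` W \<subseteq> W \<Longrightarrow> G ` W \<subseteq> W"
    and "G (G v) = 0"
  shows "G v = 0"
proof -
  define U where "U = {u. G u = 0}"
  have "subspace U"
    by (simp add: U_def subspace_def linear_0[OF G(1)] linear_add[OF G(1)] linear_scale[OF G(1)])
  moreover have "T ` U \<subseteq> U"
    by (auto simp: U_def G(2) linear_0[OF T(1)])
  ultimately have "\<exists>W. subspace W \<and> T ` W \<subseteq> W \<and> U \<inter> W = {0} \<and> {u + w |u w. u \<in> U \<and> w \<in> W} = UNIV"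
    by (intro T(2)[unfolded semisimple_def, rule_format] conjI)
  then obtain W where W: "subspace W" "T ` W \<subseteq> W" "U \<inter> W = {0}"
    and UW: "{u + w |u w. u \<in> U \<and> w \<in> W} = UNIV"
    by (elim exE conjE)
  have "v \<in> {u + w |u w. u \<in> U \<and> w \<in> W}"
    unfolding UW by (rule UNIV_I)
  then obtain u w where uw: "v = u + w" "u \<in> U" "w \<in> W"
    by (elim CollectE exE conjE)
  then have "G v = G w"
    by (simp add: U_def linear_add[OF G(1)])
  then have "G v \<in> U \<inter> W"
    using GW[OF W(1,2)] uw(3) assms(6) by (auto simp: U_def)
  then show ?thesis
    using W(3) by auto
qed

text \<open>The difference of the first and last coordinates is 2 at finite points and 0 at
  infinity, which fixes the scale.\<close>

lemma boundary_vector_ray_inject: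
  assumes "boundary_vector p = t *\<^sub>R boundary_vector q" "t > 0"
  shows "p = q"
proof (cases p; cases q)
  fix z w assume [simp]: "p = Some z" "q = Some w"
  from assms(1) have e: "(cmod z)\<^sup>2 + 1 = t * ((cmod w)\<^sup>2 + 1)" "(cmod z)\<^sup>2 - 1 = t * ((cmod w)\<^sup>2 - 1)"
      "Re z = t * Re w" "Im z = t * Im w"
    by (simp_all add: vec_eq_4 boundary_vector_def)
  moreover have "t * ((cmod w)\<^sup>2 + 1) - t * ((cmod w)\<^sup>2 - 1) = 2 * t"
    by (simp add: algebra_simps)
  ultimately have "t = 1"
    by linarith
  then show ?thesis
    using e by (simp add: complex_eq_iff)
next
  fix w assume [simp]: "p = None" "q = Some w"
  from assms(1) have "1 = t * ((cmod w)\<^sup>2 + 1)" "1 = t * ((cmod w)\<^sup>2 - 1)"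
    by (simp_all add: vec_eq_4 boundary_vector_def)
  moreover have "t * ((cmod w)\<^sup>2 + 1) - t * ((cmod w)\<^sup>2 - 1) = 2 * t"
    by (simp add: algebra_simps)
  ultimately show ?thesis
    using assms(2) by linarith
next
  fix z assume [simp]: "p = Some z" "q = None"
  from assms(1) have "(cmod z)\<^sup>2 + 1 = t" "(cmod z)\<^sup>2 - 1 = t"
    by (simp_all add: vec_eq_4 boundary_vector_def)
  then show ?thesis
    by simp
qed simp

lemma lorentz_eq_id_imp_scalar:
  assumes det: "det A \<noteq> 0" and "\<And>v. lorentz A v = v"
  shows "scalar_matrix A"
proof -
  have "moebius_map A p = p" for p
  proof -
    obtain t where "t > 0" "lorentz A (boundary_vector p) = t *\<^sub>R boundary_vector (moebius_map A p)"
      using induces_lorentz[OF det] unfolding induces_on_boundary_def by blast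
    then show ?thesis
      using boundary_vector_ray_inject assms(2) by metis
  qed
  then have "moebius_map A = id"
    by auto
  then show ?thesis
    by (rule moebius_map_eq_id_imp_scalar[OF det])
qed

lemma cayley_hamilton_2:
  fixes A :: "complex^2^2"
  assumes "trace A = 2 * x" "det A = x\<^sup>2"
  shows "(A - mat x) ** (A - mat x) = 0"
proof -
  have "A$1$1 + A$2$2 = 2 * x" "A$1$1 * A$2$2 - A$1$2 * A$2$1 = x\<^sup>2"
    using assms by (simp_all add: trace_2 det_2)
  then show ?thesis
    by (simp add: matrix_eq_2 matrix_mult_2_nth power2_eq_square) algebra
qed

lemma mult_zero_matrix: "0 ** X = 0" "X ** 0 = 0" for X :: "complex^2^2"
  by (simp_all add: matrix_eq_2 matrix_mult_2_nth)

text \<open>\<open>g\<close> is X \<mapsto> (1 + N) X (1 + M) - X. Left multiplication by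
  \<open>N\<close> and right multiplication by \<open>M\<close> commute and square to zero, so g (g
  X) is twice N X M, which \<open>g\<close> kills.\<close>

lemma unipotent_action_nilpotent:
  fixes N M :: "complex^2^2"
  assumes "N ** N = 0" "M ** M = 0"
  defines "g \<equiv> \<lambda>X. N ** X + X ** M + N ** X ** M"
  shows "g (g (g X)) = 0"
proof -
  have z: "N ** N ** Y = 0" "Y ** N ** N = 0" "Y ** M ** M = 0" for Y
    by (simp_all add: assms matrix_mul_assoc[symmetric] mult_zero_matrix)
  have add: "g (Y + Z) = g Y + g Z" for Y Z
    by (simp add: g_def matrix_add_ldistrib matrix_add_rdistrib)
  have 0: "g (N ** X ** M) = 0"
    by (simp add: g_def matrix_mul_assoc assms(1) z mult_zero_matrix)
  have "g (g X) = N ** X ** M + N ** X ** M"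
    by (simp add: g_def matrix_add_ldistrib matrix_add_rdistrib matrix_mul_assoc assms(1) z
        mult_zero_matrix)
  then show ?thesis
    by (simp only: add 0 add_0)
qed

text \<open>The double eigenvalue \<delta> gives A = \<delta> (1 + N) with N^2 = 0, and the factor
  \<delta>^2 cancels against the normalization of \<open>lorentz\<close>.\<close>

lemma lorentz_unipotent_cubed:
  assumes "\<delta> > 0" "trace A = complex_of_real (2 * \<delta>)" "det A = complex_of_real (\<delta>\<^sup>2)"
  defines "G \<equiv> \<lambda>v. lorentz A v - v"
  shows "G (G (G v)) = 0"
proof -
  define N where "N = (A - mat (complex_of_real \<delta>)) /\<^sub>R \<delta>"
  define M where "M = ctrans N"
  have "(A - mat (complex_of_real \<delta>)) ** (A - mat (complex_of_real \<delta>)) = 0"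
    using assms by (intro cayley_hamilton_2) simp_all
  then have NN: "N ** N = 0"
    by (simp add: N_def matrix_scalar_ac scalar_matrix_assoc[symmetric])
  have "ctrans 0 = 0"
    by (simp add: matrix_eq_2)
  then have MM: "M ** M = 0"
    using NN by (metis M_def ctrans_mult)
  define g where "g = (\<lambda>X. N ** X + X ** M + N ** X ** M)"
  have A: "A = \<delta> *\<^sub>R (mat 1 + N)"
    using assms(1) by (simp add: N_def matrix_eq_2) (simp add: scaleR_conv_of_real field_simps)
  have "ctrans A = \<delta> *\<^sub>R (mat 1 + M)"
    unfolding A M_def by (simp add: matrix_eq_2)
  then have "A ** X ** ctrans A = \<delta>\<^sup>2 *\<^sub>R ((mat 1 + N) ** X ** (mat 1 + M))" for X
    unfolding A by (simp add: matrix_scalar_ac scalar_matrix_assoc[symmetric] power2_eq_square)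
  then have "A ** X ** ctrans A = \<delta>\<^sup>2 *\<^sub>R (X + g X)" for X
    by (simp add: g_def matrix_add_ldistrib matrix_add_rdistrib)
  then have "herm (lorentz A v) = herm v + g (herm v)" for v
    using assms(1) by (simp add: herm_lorentz assms(3) norm_power)
  then have hG: "herm (G v) = g (herm v)" for v
    by (simp add: G_def linear_diff[OF linear_herm])
  have "herm (G (G (G v))) = 0"
    using unipotent_action_nilpotent[OF NN MM] by (simp add: hG g_def)
  then show ?thesis
    using herm_inject linear_0[OF linear_herm] by metis
qed

lemma parabolic_lorentz_vconj:
  assumes det: "det A \<noteq> 0" and "anti_trace A = 2" and ns: "\<not> scalar_matrix (A ** map_matrix cnj A)"
  shows "parabolic (lorentz A \<circ> vconj)"
  unfolding parabolic_def
proof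
  let ?T = "lorentz A \<circ> vconj" and ?B = "A ** map_matrix cnj A"
  assume ss: "semisimple ?T"
  define G where "G v = lorentz ?B v - v" for v
  \<comment> \<open>As a polynomial in \<open>?T\<close>, \<open>G\<close> commutes with
    \<open>?T\<close> and preserves its invariant subspaces.\<close>
  have GT: "G v = ?T (?T v) - v" for v
    unfolding G_def lorentz_vconj_twice by simp
  have "linear G"
    unfolding G_def by (intro linear_compose_sub linear_lorentz linear_ident)
  have T: "linear ?T"
    by (rule linear_lorentz_vconj)
  have comm: "G (?T v) = ?T (G v)" for v
    unfolding GT by (simp only: linear_diff[OF T])
  have GW: "G ` W \<subseteq> W" if "subspace W" "?T ` W \<subseteq> W" for W
    using that by (auto simp: GT image_subset_iff intro!: subspace_diff simp del: o_apply)
  \<comment> \<open>Applied twice, this reduces the vanishing of the third power of \<open>G\<close>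
    to that of \<open>G\<close> itself.\<close>
  have "G (G v) = 0 \<Longrightarrow> G v = 0" for v
    by (rule semisimple_imp_ker_square[OF T ss \<open>linear G\<close> comm GW])
  moreover have "G (G (G v)) = 0" for v
    unfolding G_def using det assms(2)
    by (intro lorentz_unipotent_cubed[of "cmod (det A)"])
       (simp_all add: trace_mult_cnj det_mult_cnj)
  ultimately have "G v = 0" for v
    by blast
  then have "lorentz ?B v = v" for v
    by (simp add: G_def)
  then show False
    using ns lorentz_eq_id_imp_scalar[of ?B] det by (simp add: det_mult_cnj)
qed

text \<open>If \<open>\<xi>\<close> spans an eigenspace of \<open>A \<bar>A\<close> with eigenvalue \<open>-\<delta> < 0\<close>, then \<open>A \<bar>\<xi>\<close> is another
  eigenvector, and it is independent of \<open>\<xi>\<close> because the square of the antilinear map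
  \<open>\<xi> \<mapsto> A \<bar>\<xi>\<close> is negative.\<close>

lemma anti_trace_neg_2_imp_scalar:
  assumes det: "det A \<noteq> 0" and "anti_trace A = - 2"
  shows "scalar_matrix (A ** map_matrix cnj A)"
proof -
  define B where "B = A ** map_matrix cnj A"
  define \<delta> where "\<delta> = cmod (det A)"
  define N where "N = B + mat (complex_of_real \<delta>)"
  define J where "J v = A *v (\<chi> i. cnj (v $ i))" for v
  have "\<delta> > 0"
    using det by (simp add: \<delta>_def)
  have JJ: "J (J v) = B *v v" for v
    by (simp add: J_def B_def vec_eq_2 matrix_vector_mult_2_nth matrix_mult_2_nth algebra_simps)
  have Jc: "J (c *s v) = cnj c *s J v" for c v
    by (simp add: J_def vec_eq_2 matrix_vector_mult_2_nth algebra_simps)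
  have tr: "trace B = complex_of_real (- 2 * \<delta>)" "det B = complex_of_real (\<delta>\<^sup>2)"
    using trace_mult_cnj[OF det] assms(2) by (simp_all add: B_def \<delta>_def det_mult_cnj)
  \<comment> \<open>The characteristic polynomial of \<open>B\<close> at -\<delta>, which is a
    double root.\<close>
  have "det N = det B + complex_of_real \<delta> * trace B + (complex_of_real \<delta>)\<^sup>2"
    by (simp add: N_def det_2 trace_2 power2_eq_square algebra_simps)
  also have "\<dots> = 0"
    by (simp add: tr power2_eq_square)
  finally obtain \<xi> where \<xi>: "\<xi> \<noteq> 0" "N *v \<xi> = 0"
    using kernel_if_det_0 by blast
  have N: "N *v v = 0 \<longleftrightarrow> B *v v = (- complex_of_real \<delta>) *s v" for v
  proof -
    have "N *v v = B *v v - (- complex_of_real \<delta>) *s v"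
      by (simp add: N_def vec_eq_2 matrix_vector_mult_2_nth algebra_simps)
    then show ?thesis
      by (simp only: right_minus_eq)
  qed
  define \<eta> where "\<eta> = J \<xi>"
  have J\<eta>: "J \<eta> = (- complex_of_real \<delta>) *s \<xi>"
    using \<xi>(2) N JJ by (simp add: \<eta>_def)
  have "B *v \<eta> = J (J \<eta>)"
    by (simp add: JJ)
  also have "\<dots> = (- complex_of_real \<delta>) *s \<eta>"
    by (simp only: J\<eta> Jc) (simp add: \<eta>_def)
  finally have N\<eta>: "N *v \<eta> = 0"
    using N by blast
  have "\<eta> \<noteq> c *s \<xi>" for c
  proof
    assume c: "\<eta> = c *s \<xi>"
    have "(- complex_of_real \<delta>) *s \<xi> = J (c *s \<xi>)"
      using J\<eta> c by simp
    also have "\<dots> = (cnj c * c) *s \<xi>"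
      using c by (simp add: Jc \<eta>_def[symmetric])
    finally have "- complex_of_real \<delta> = cnj c * c"
      using \<xi>(1) by (simp only: vec.scale_cancel_right) simp
    then have "complex_of_real (- \<delta>) = complex_of_real ((cmod c)\<^sup>2)"
      by (simp only: complex_norm_square) (simp add: mult.commute)
    then have "- \<delta> = (cmod c)\<^sup>2"
      using of_real_eq_iff by blast
    then show False
      using \<open>\<delta> > 0\<close> zero_le_power2[of "cmod c"] by linarith
  qed
  \<comment> \<open>Its columns are independent and lie in the kernel of \<open>N\<close>, which
    forces \<open>N\<close> to vanish.\<close>
  define P :: "complex^2^2" where "P = vector [vector [\<xi>$1, \<eta>$1], vector [\<xi>$2, \<eta>$2]]"
  have "det P \<noteq> 0"
  proof
    assume "det P = 0"
    then have p: "\<xi>$1 * \<eta>$2 = \<eta>$1 * \<xi>$2"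
      by (simp add: P_def det_2)
    have "\<eta> = (\<eta>$1 / \<xi>$1) *s \<xi>" if "\<xi>$1 \<noteq> 0"
      using p that by (simp add: vec_eq_2 field_simps)
    moreover have "\<eta> = (\<eta>$2 / \<xi>$2) *s \<xi>" if "\<xi>$1 = 0"
      using p that \<xi>(1) by (auto simp: vec_eq_2)
    ultimately show False
      using \<open>\<And>c. \<eta> \<noteq> c *s \<xi>\<close> by blast
  qed
  then obtain P' where "P ** P' = mat 1"
    using inverse_of_det_nonzero by blast
  moreover have "N ** P = 0"
    using \<xi>(2) N\<eta> by (simp add: matrix_eq_2 matrix_mult_2_nth P_def vec_eq_2 matrix_vector_mult_2_nth)
  ultimately have "N = 0"
    by (metis matrix_mul_assoc matrix_mul_rid mult_zero_matrix(1))
  then have "B = mat (- complex_of_real \<delta>)"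
    by (simp add: N_def matrix_eq_2 add_eq_0_iff2)
  then show ?thesis
    unfolding scalar_matrix_def B_def by blast
qed

theorem rotatory_parabolic_inversion_if_anti_trace_2:
  assumes det: "det A \<noteq> 0" and "(anti_trace A)\<^sup>2 = 4"
    and ns: "\<not> scalar_matrix (A ** map_matrix cnj A)"
  shows "rotatory_parabolic_inversion 0 (anti_moebius_map A)"
proof -
  have "anti_trace A = 2 \<or> anti_trace A = - 2"
    using assms(2) power2_eq_iff[of "anti_trace A" 2] by simp
  then have 2: "anti_trace A = 2"
    using anti_trace_neg_2_imp_scalar[OF det] ns by blast
  have "charpoly (lorentz A \<circ> vconj) = [:-1, 1:] ^ 3 * [:1, 1:] ^ 1"
    unfolding charpoly_lorentz_vconj[OF det] 2 by (simp add: eval_nat_numeral)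
  then have "parabolic_type 0 1 (lorentz A \<circ> vconj)"
    using parabolic_lorentz_vconj[OF det 2 ns] rotatory_factorization_unipotent[of 3 1]
    by (simp add: parabolic_type_def)
  then show ?thesis
    unfolding rotatory_parabolic_inversion_def as_H3_isometry_def
    using H3_isometry_lorentz_vconj[OF det] induces_lorentz_vconj[OF det] odd_one by blast
qed

section \<open>Circle inversions and antipodal maps\<close>

lemma anti_moebius_map_smult:
  "u \<noteq> 0 \<Longrightarrow> anti_moebius_map (map_matrix ((*) u) A) = anti_moebius_map A"
proof (rule ext)
  fix p assume "u \<noteq> 0"
  have "map_matrix ((*) u) A *v w = u *s (A *v w)" for w
    by (simp add: vec_eq_2 matrix_vector_mult_2_nth algebra_simps)
  then show "anti_moebius_map (map_matrix ((*) u) A) p = anti_moebius_map A p"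
    using \<open>u \<noteq> 0\<close> by (simp add: anti_moebius_map_def moebius_map_eq_sphere_point sphere_point_smult)
qed

lemma det_smult_2: "det (map_matrix ((*) u) A) = u\<^sup>2 * det A" for A :: "complex^2^2"
  by (simp add: det_2 power2_eq_square algebra_simps)

lemma anti_trace_smult:
  assumes "u \<noteq> 0"
  shows "anti_trace (map_matrix ((*) u) A) = anti_trace A"
proof -
  let ?M = "map_matrix ((*) u) A"
  have "trace (?M ** map_matrix cnj ?M) = (u * cnj u) * trace (A ** map_matrix cnj A)"
    by (simp add: trace_2 matrix_mult_2_nth algebra_simps)
  also have "\<dots> = complex_of_real ((cmod u)\<^sup>2) * trace (A ** map_matrix cnj A)"
    by (simp only: complex_norm_square)
  finally have eq: "trace (?M ** map_matrix cnj ?M)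
      = complex_of_real ((cmod u)\<^sup>2) * trace (A ** map_matrix cnj A)" .
  have "Re (trace (?M ** map_matrix cnj ?M)) = (cmod u)\<^sup>2 * Re (trace (A ** map_matrix cnj A))"
    unfolding eq times_complex.sel Re_complex_of_real Im_complex_of_real by simp
  moreover have "(cmod u)\<^sup>2 \<noteq> 0"
    using assms by simp
  ultimately show ?thesis
    unfolding anti_trace_def det_smult_2 norm_mult norm_power by (metis mult_divide_mult_cancel_left)
qed

lemma inversion_formE:
  assumes "inversion_form M"
  obtains a b c where "M = vector [vector [a, complex_of_real b], vector [complex_of_real c, - cnj a]]"
    "det M = complex_of_real (- ((cmod a)\<^sup>2 + b * c))"
proof -
  obtain b c where "M$1$2 = complex_of_real b" "M$2$1 = complex_of_real c"
    using assms unfolding inversion_form_def by (auto elim!: Reals_cases)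
  moreover have "M$2$2 = - cnj (M$1$1)"
    using assms by (simp add: inversion_form_def)
  ultimately have "M = vector [vector [M$1$1, complex_of_real b], vector [complex_of_real c, - cnj (M$1$1)]]"
    "det M = complex_of_real (- ((cmod (M$1$1))\<^sup>2 + b * c))"
    by (simp_all add: matrix_eq_2 det_2 complex_norm_square[symmetric])
  then show ?thesis
    by (rule that)
qed

lemma circle_inversion_fixes_point:
  assumes "circle_inversion f"
  obtains p where "f p = p"
  using assms unfolding circle_inversion_def
proof (elim disjE exE conjE)
  fix q :: complex and R :: real assume "R > 0" "f = round_circle_inversion q R"
  then have "f (Some (q + complex_of_real R)) = Some (q + complex_of_real R)"
    by (simp add: round_circle_inversion_def power2_eq_square)
  then show thesis
    by (rule that)
next
  fix q u assume "f = line_inversion q u"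
  then have "f (Some q) = Some q"
    by (simp add: line_inversion_def)
  then show thesis
    by (rule that)
qed

lemma not_antipodal_if_circle_inversion: "circle_inversion f \<Longrightarrow> \<not> antipodal_map f"
  using circle_inversion_fixes_point antipodal_map_def by metis

text \<open>The fixed points satisfy c |z|^2 - 2 Re (cnj a z) = b. This is the circle with centre a
  / c and radius sqrt (-d) / |c|, or a line if c = 0.\<close>

lemma circle_inversion_if_det_neg:
  assumes M: "inversion_form M" "det M = complex_of_real d" and "d < 0"
  shows "circle_inversion (anti_moebius_map M)"
proof -
  obtain a b c where abc: "M = vector [vector [a, complex_of_real b], vector [complex_of_real c, - cnj a]]"
    "det M = complex_of_real (- ((cmod a)\<^sup>2 + b * c))"
    by (rule inversion_formE[OF M(1)])
  have d: "- d = (cmod a)\<^sup>2 + b * c"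
    using M(2) abc(2) of_real_eq_iff by (metis add.inverse_inverse)
  have aa: "complex_of_real (- d) = a * cnj a + complex_of_real b * complex_of_real c"
    unfolding d by (simp only: of_real_add of_real_mult complex_norm_square)
  show ?thesis
  proof (cases "c = 0")
    case False
    define p R where "p = a / complex_of_real c" "R = sqrt (- d) / \<bar>c\<bar>"
    note defs = this
    have "R > 0"
      using \<open>d < 0\<close> False by (simp add: defs)
    have R2: "complex_of_real (R\<^sup>2) = complex_of_real (- d) / (complex_of_real c)\<^sup>2"
      using \<open>d < 0\<close> by (simp add: defs power_divide)
    have "anti_moebius_map M q = round_circle_inversion p R q" for q
    proof (cases q)
      case None
      then show ?thesis
        using False by (simp add: anti_moebius_map_def moebius_map_def round_circle_inversion_def abc(1) defs)
    next
      case (Some z)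
      have n: "complex_of_real c * cnj z - cnj a = complex_of_real c * cnj (z - p)"
        using False by (simp add: defs field_simps)
      then have iff: "complex_of_real c * cnj z - cnj a = 0 \<longleftrightarrow> z = p"
        using False by simp
      have "(a * cnj z + complex_of_real b) / (complex_of_real c * cnj z - cnj a)
          = p + complex_of_real (R\<^sup>2) / cnj (z - p)" if "z \<noteq> p"
      proof -
        have "cnj (z - p) \<noteq> 0"
          using that by simp
        \<comment> \<open>Division of the numerator by the denominator, with quotient
          \<open>p\<close> and constant remainder.\<close>
        moreover have "a * cnj z + complex_of_real b = p * (complex_of_real c * cnj (z - p))
            + complex_of_real (R\<^sup>2) * complex_of_real c"
          unfolding R2 aa using False by (simp add: defs field_simps power2_eq_square)
        ultimately show ?thesis
          unfolding n using False by (simp add: add_divide_distrib del: complex_cnj_diff)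
      qed
      then show ?thesis
        using Some iff
        by (simp add: anti_moebius_map_def moebius_map_def round_circle_inversion_def abc(1)
            del: of_real_power)
    qed
    then show ?thesis
      using \<open>R > 0\<close> unfolding circle_inversion_def by blast
  next
    case True
    then have "a \<noteq> 0"
      using d \<open>d < 0\<close> by auto
    \<comment> \<open>The fixed line is 2 Re (cnj a z) = -b: \<open>p\<close> is the foot of the
      perpendicular from 0, and \<open>u\<close> is a unit vector orthogonal to
      \<open>a\<close>.\<close>
    define p u where "p = - complex_of_real b / (2 * cnj a)" "u = csqrt (- (a / cnj a))"
    note defs = this
    have u2: "u\<^sup>2 = - (a / cnj a)"
      by (simp add: defs)
    then have "(cmod u)\<^sup>2 = 1"
      using \<open>a \<noteq> 0\<close> by (metis complex_mod_cnj divide_self norm_divide norm_eq_zero norm_minus_cancel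
          norm_power)
    then have "cmod u = 1"
      using norm_ge_zero[of u] by (auto simp: power2_eq_1_iff)
    have "p + u\<^sup>2 * cnj (z - p) = (a * cnj z + complex_of_real b) / (- cnj a)" for z
      using \<open>a \<noteq> 0\<close> unfolding u2 by (simp add: defs field_simps)
    then have "anti_moebius_map M q = line_inversion p u q" for q
      using True \<open>a \<noteq> 0\<close>
      by (cases q) (simp_all add: anti_moebius_map_def moebius_map_def line_inversion_def abc(1)
          del: complex_cnj_diff)
    then show ?thesis
      using \<open>cmod u = 1\<close> unfolding circle_inversion_def by blast
  qed
qed

text \<open>\<open>M\<close> times its conjugate is the scalar -d, so the map is an involution. A
  finite fixed point z would satisfy |c z - a|^2 = -d < 0, and infinity is moved because c is
  nonzero.\<close>

lemma antipodal_map_if_det_pos: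
  assumes M: "inversion_form M" "det M = complex_of_real d" and "d > 0"
  shows "antipodal_map (anti_moebius_map M)"
proof -
  obtain a b c where abc: "M = vector [vector [a, complex_of_real b], vector [complex_of_real c, - cnj a]]"
    "det M = complex_of_real (- ((cmod a)\<^sup>2 + b * c))"
    by (rule inversion_formE[OF M(1)])
  have d: "- d = (cmod a)\<^sup>2 + b * c"
    using M(2) abc(2) of_real_eq_iff by (metis add.inverse_inverse)
  have aa: "complex_of_real (- d) = a * cnj a + complex_of_real b * complex_of_real c"
    unfolding d by (simp only: of_real_add of_real_mult complex_norm_square)
  have c: "c \<noteq> 0"
  proof
    assume "c = 0"
    then have "(cmod a)\<^sup>2 = - d"
      using d by simp
    then show False
      using \<open>d > 0\<close> zero_le_power2[of "cmod a"] by linarith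
  qed
  have det: "det M \<noteq> 0"
    using M(2) \<open>d > 0\<close> by simp
  have "M ** map_matrix cnj M = mat (complex_of_real (- d))"
    unfolding aa by (simp add: matrix_eq_2 matrix_mult_2_nth abc(1))
  then have "anti_moebius_map M \<circ> anti_moebius_map M = id"
    using \<open>d > 0\<close> by (simp add: anti_moebius_map_comp_self[OF det] moebius_map_scalar)
  moreover have fix_free: "anti_moebius_map M q \<noteq> q" for q
  proof (cases q)
    case None
    then show ?thesis
      using c by (simp add: anti_moebius_map_def moebius_map_def abc(1))
  next
    case (Some z)
    show ?thesis
    proof
      assume "anti_moebius_map M q = q"
      then have "complex_of_real c * cnj z - cnj a \<noteq> 0"
        "(a * cnj z + complex_of_real b) / (complex_of_real c * cnj z - cnj a) = z"
        using Some by (auto simp: anti_moebius_map_def moebius_map_def abc(1) split: if_splits)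
      then have "a * cnj z + complex_of_real b = z * (complex_of_real c * cnj z - cnj a)"
        by (simp add: field_simps)
      then have "(complex_of_real c * z - a) * (complex_of_real c * cnj z - cnj a)
          = a * cnj a + complex_of_real b * complex_of_real c"
        by algebra
      moreover have "complex_of_real c * cnj z - cnj a = cnj (complex_of_real c * z - a)"
        by simp
      ultimately have "complex_of_real ((cmod (complex_of_real c * z - a))\<^sup>2) = complex_of_real (- d)"
        unfolding aa by (simp only: complex_norm_square)
      then have "(cmod (complex_of_real c * z - a))\<^sup>2 = - d"
        using of_real_eq_iff by blast
      then show False
        using \<open>d > 0\<close> zero_le_power2[of "cmod (complex_of_real c * z - a)"] by linarith
    qed
  qed
  ultimately show ?thesis
    using det unfolding antipodal_map_def by (metis id_apply)
qed

lemma anti_trace_inversion_form: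
  assumes M: "inversion_form M" "det M = complex_of_real d" and "d \<noteq> 0"
  shows "anti_trace M = - 2 * sgn d"
proof -
  obtain a b c where abc: "M = vector [vector [a, complex_of_real b], vector [complex_of_real c, - cnj a]]"
    "det M = complex_of_real (- ((cmod a)\<^sup>2 + b * c))"
    by (rule inversion_formE[OF M(1)])
  have d: "- d = (cmod a)\<^sup>2 + b * c"
    using M(2) abc(2) of_real_eq_iff by (metis add.inverse_inverse)
  have aa: "complex_of_real (- d) = a * cnj a + complex_of_real b * complex_of_real c"
    unfolding d by (simp only: of_real_add of_real_mult complex_norm_square)
  have "trace (M ** map_matrix cnj M) = 2 * complex_of_real (- d)"
    unfolding aa by (simp add: trace_2 matrix_mult_2_nth abc(1))
  then have "anti_trace M = - 2 * d / \<bar>d\<bar>"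
    unfolding anti_trace_def M(2) by simp
  then show ?thesis
    by (simp add: sgn_real_def abs_if)
qed

text \<open>Comparing the two forms shows that (s - cnj s) annihilates the matrix for s = v / u;
  some entry is nonzero, so s is real.\<close>

lemma inversion_form_unique:
  assumes "det A \<noteq> 0" "u \<noteq> 0" "v \<noteq> 0"
    and "inversion_form (map_matrix ((*) u) A)" "inversion_form (map_matrix ((*) v) A)"
  shows "\<exists>t::real. t \<noteq> 0 \<and> v = complex_of_real t * u"
proof -
  define s where "s = v / u"
  define M where "M = map_matrix ((*) u) A"
  have sM: "map_matrix ((*) v) A = map_matrix ((*) s) M"
    using assms(2) by (simp add: s_def M_def matrix_eq_2)
  have M: "M$2$2 = - cnj (M$1$1)" "cnj (M$1$2) = M$1$2" "cnj (M$2$1) = M$2$1"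
    using assms(4) by (simp_all add: M_def[symmetric] inversion_form_def Reals_cnj_iff)
  have "s * M$2$2 = - cnj (s * M$1$1)" "cnj (s * M$1$2) = s * M$1$2" "cnj (s * M$2$1) = s * M$2$1"
    using assms(5) by (simp_all add: sM inversion_form_def Reals_cnj_iff)
  then have "(s - cnj s) * M$1$1 = 0 \<or> M$1$1 = 0" "(s - cnj s) * M$1$2 = 0" "(s - cnj s) * M$2$1 = 0"
      "(s - cnj s) * M$2$2 = 0"
    using M by (auto simp: algebra_simps)
  moreover have "det M \<noteq> 0"
    using assms(1,2) by (simp add: M_def det_smult_2)
  then have "M$2$2 \<noteq> 0 \<or> M$1$2 \<noteq> 0"
    by (auto simp: det_2)
  ultimately have "s = cnj s"
    by auto
  then obtain t where "s = complex_of_real t"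
    by (metis Reals_cases Reals_cnj_iff)
  then show ?thesis
    using assms(2,3) by (intro exI[of _ t]) (auto simp: s_def field_simps)
qed

text \<open>If A times its conjugate is \<beta>, then A equals \<omega> times the adjugate of its
  conjugate, with |\<omega>| = 1. The inversion form for uA then amounts to u \<omega> = - cnj
  u.\<close>

lemma inversion_form_exists:
  assumes det: "det A \<noteq> 0" and "scalar_matrix (A ** map_matrix cnj A)"
  obtains u where "u \<noteq> 0" "inversion_form (map_matrix ((*) u) A)"
proof -
  obtain \<beta> where \<beta>: "A ** map_matrix cnj A = mat \<beta>"
    using assms(2) scalar_matrix_def by blast
  define a b c d D where "a = A$1$1" "b = A$1$2" "c = A$2$1" "d = A$2$2" "D = cnj (det A)"
  note defs = this
  have "D \<noteq> 0"
    using det by (simp add: defs)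
  have "det (A ** map_matrix cnj A) = det A * D"
    by (simp only: det_mul det_map_cnj defs)
  then have \<beta>2: "\<beta>\<^sup>2 = cnj D * D"
    unfolding \<beta> by (simp add: det_2 defs power2_eq_square)
  have "\<beta> = cnj \<beta>"
  proof -
    have "trace (A ** map_matrix cnj A) = 2 * \<beta>"
      unfolding \<beta> by (simp add: trace_2)
    then have "2 * \<beta> \<in> \<real>"
      using trace_mult_cnj_real[of A] by simp
    then show ?thesis
      by (simp add: complex_is_Real_iff complex_eq_iff)
  qed
  define \<omega> where "\<omega> = \<beta> / D"
  have "\<omega> * cnj \<omega> = 1"
  proof -
    have "\<beta> * cnj \<beta> = D * cnj D"
      using \<beta>2 \<open>\<beta> = cnj \<beta>\<close> by (metis mult.commute power2_eq_square)
    then show ?thesis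
      using \<open>D \<noteq> 0\<close> by (simp add: \<omega>_def)
  qed
  have e: "a * cnj a + b * cnj c = \<beta>" "a * cnj b + b * cnj d = 0"
      "c * cnj a + d * cnj c = 0" "c * cnj b + d * cnj d = \<beta>" "D = cnj a * cnj d - cnj b * cnj c"
    using \<beta> by (simp_all add: matrix_eq_2 matrix_mult_2_nth det_2 defs)
  \<comment> \<open>The entries of A times its conjugate times the adjugate of that
    conjugate.\<close>
  have "D * a = cnj d * (a * cnj a + b * cnj c) - cnj c * (a * cnj b + b * cnj d)"
    "D * b = cnj a * (a * cnj b + b * cnj d) - cnj b * (a * cnj a + b * cnj c)"
    "D * c = cnj d * (c * cnj a + d * cnj c) - cnj c * (c * cnj b + d * cnj d)"
    "D * d = cnj a * (c * cnj b + d * cnj d) - cnj b * (c * cnj a + d * cnj c)"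
    unfolding e(5) by (simp_all only: algebra_simps)
  then have "D * a = \<beta> * cnj d" "D * b = - \<beta> * cnj b" "D * c = - \<beta> * cnj c" "D * d = \<beta> * cnj a"
    unfolding e(1-4) by simp_all
  then have A: "a = \<omega> * cnj d" "b = - \<omega> * cnj b" "c = - \<omega> * cnj c" "d = \<omega> * cnj a"
    using \<open>D \<noteq> 0\<close> by (simp_all add: \<omega>_def field_simps)
  have "cmod \<omega> = 1"
  proof -
    have "(cmod \<omega>)\<^sup>2 = 1"
      using \<open>\<omega> * cnj \<omega> = 1\<close> complex_norm_square[of \<omega>] by (metis of_real_1 of_real_eq_iff)
    then show ?thesis
      using norm_ge_zero[of \<omega>] by (auto simp: power2_eq_1_iff)
  qed
  define s where "s = csqrt \<omega>"
  have s2: "\<omega> = s\<^sup>2"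
    by (simp add: s_def)
  have s1: "s * cnj s = 1"
  proof -
    have "cmod s = 1"
      using \<open>cmod \<omega> = 1\<close> by (simp add: s_def norm_csqrt)
    then show ?thesis
      by (metis complex_norm_square of_real_1 one_power2)
  qed
  \<comment> \<open>For s of modulus 1 with square \<omega>, this choice solves u \<omega> = - cnj
    u.\<close>
  define u where "u = \<i> * cnj s"
  have "u * \<omega> = \<i> * s * (s * cnj s)"
    unfolding s2 u_def by (simp add: power2_eq_square)
  also have "\<dots> = - cnj u"
    unfolding s1 u_def by simp
  finally have u\<omega>: "u * \<omega> = - cnj u" .
  have u0: "u \<noteq> 0"
    using s1 by (auto simp: u_def)
  have "u * d = u * \<omega> * cnj a"
    by (subst A(4)) (rule mult.assoc[symmetric])
  moreover have "u * b = - (u * \<omega> * cnj b)"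
    by (subst A(2)) simp
  moreover have "u * c = - (u * \<omega> * cnj c)"
    by (subst A(3)) simp
  ultimately have "u * d = - cnj (u * a)" "cnj (u * b) = u * b" "cnj (u * c) = u * c"
    unfolding u\<omega> by simp_all
  then have "inversion_form (map_matrix ((*) u) A)"
    by (simp add: inversion_form_def Reals_cnj_iff defs)
  with u0 show ?thesis
    by (rule that)
qed

text \<open>The squared map acts trivially and so fixes the identity matrix, which gives
  ellipticity. The eigenvalue -1 has multiplicity 1 or 3 according to the sign of
  \<open>anti_trace A\<close>, hence rotation number 0 or 1.\<close>

lemma rotatory_elliptic_inversion_if_square_scalar:
  assumes det: "det A \<noteq> 0" and "scalar_matrix (A ** map_matrix cnj A)"
  shows "anti_trace A = 2 \<Longrightarrow> rotatory_elliptic_inversion 0 (anti_moebius_map A)"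
    and "anti_trace A = - 2 \<Longrightarrow> rotatory_elliptic_inversion 1 (anti_moebius_map A)"
proof -
  let ?T = "lorentz A \<circ> vconj" and ?B = "A ** map_matrix cnj A"
  obtain \<beta> where \<beta>: "?B = mat \<beta>"
    using assms(2) scalar_matrix_def by blast
  have "\<beta> \<noteq> 0"
    using \<beta> det_mult_cnj[of A] det by (auto simp: det_2)
  define e :: "real^4" where "e = vector [1, 0, 0, 0]"
  have "inverse (complex_of_real (cmod \<beta>)) * inverse (complex_of_real (cmod \<beta>))
      * (complex_of_real (cmod \<beta>) * complex_of_real (cmod \<beta>)) = 1"
    using \<open>\<beta> \<noteq> 0\<close> by (simp add: field_simps)
  then have "herm (lorentz (mat \<beta>) e) = herm e"
    by (simp add: herm_lorentz matrix_eq_2 matrix_mult_2_nth e_def det_2 norm_mult)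
      (simp add: scaleR_conv_of_real complex_norm_square[symmetric] power2_eq_square Complex_eq_0)
  then have "lorentz ?B e = e"
    by (simp add: \<beta> herm_inject)
  moreover have "e \<in> forward_cone"
    by (simp add: e_def forward_cone_def Q_def)
  ultimately have ell: "elliptic ?T"
    using elliptic_lorentz_vconj[OF det] by blast
  have *: "rotatory_elliptic_inversion (m div 2) (anti_moebius_map A)"
    if "charpoly ?T = [:-1, 1:] ^ l * [:1, 1:] ^ m" "odd m" for l m
  proof -
    have "elliptic_type (m div 2) m ?T"
      using ell that(1) rotatory_factorization_unipotent by (simp add: elliptic_type_def)
    then show ?thesis
      unfolding rotatory_elliptic_inversion_def as_H3_isometry_def
      using H3_isometry_lorentz_vconj[OF det] induces_lorentz_vconj[OF det] that(2) by blast
  qed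
  show "rotatory_elliptic_inversion 0 (anti_moebius_map A)" if "anti_trace A = 2"
    using *[of 3 1] that unfolding charpoly_lorentz_vconj[OF det] by (simp add: power3_eq_cube)
  show "rotatory_elliptic_inversion 1 (anti_moebius_map A)" if "anti_trace A = - 2"
    using *[of 1 3] that unfolding charpoly_lorentz_vconj[OF det] by (simp add: power3_eq_cube)
qed

lemma inversion_form_cases:
  assumes det: "det A \<noteq> 0" and u: "u \<noteq> 0" "inversion_form (map_matrix ((*) u) A)"
  obtains d where "det (map_matrix ((*) u) A) = complex_of_real d"
    "(d < 0 \<and> circle_inversion (anti_moebius_map A) \<and> anti_trace A = 2) \<or>
     (d > 0 \<and> antipodal_map (anti_moebius_map A) \<and> anti_trace A = - 2)"
proof -
  let ?M = "map_matrix ((*) u) A"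
  obtain d where d: "det ?M = complex_of_real d"
    using inversion_formE[OF u(2)] by metis
  have "det ?M \<noteq> 0"
    using det u(1) by (simp add: det_smult_2)
  then have "d \<noteq> 0"
    using d by auto
  then have t: "anti_trace A = - 2 * sgn d"
    using anti_trace_inversion_form[OF u(2) d] anti_trace_smult[OF u(1)] by simp
  show ?thesis
  proof (cases "d < 0")
    case True
    then have "circle_inversion (anti_moebius_map A)"
      using circle_inversion_if_det_neg[OF u(2) d] anti_moebius_map_smult[OF u(1)] by simp
    then show ?thesis
      using that d True t by simp
  next
    case False
    then have "d > 0"
      using \<open>d \<noteq> 0\<close> by simp
    moreover have "antipodal_map (anti_moebius_map A)"
      using antipodal_map_if_det_pos[OF u(2) d] anti_moebius_map_smult[OF u(1)] calculation by simp
    ultimately show ?thesis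
      using that d t by simp
  qed
qed

lemma square_scalar_cases:
  assumes det: "det A \<noteq> 0" and s: "scalar_matrix (A ** map_matrix cnj A)"
  defines "f \<equiv> anti_moebius_map A"
  shows "(circle_inversion f \<and> \<not> antipodal_map f \<and> rotatory_elliptic_inversion 0 f) \<or>
    (antipodal_map f \<and> \<not> circle_inversion f \<and> rotatory_elliptic_inversion 1 f)"
proof -
  obtain u where "u \<noteq> 0" "inversion_form (map_matrix ((*) u) A)"
    by (rule inversion_form_exists[OF det s])
  then show ?thesis
    using inversion_form_cases[OF det] rotatory_elliptic_inversion_if_square_scalar[OF det s]
      not_antipodal_if_circle_inversion unfolding f_def by metis
qed

section \<open>Assembly of the two classifications\<close>

lemma cmod_real_minus_2_cases:
  assumes "w \<in> \<real>"
  obtains t where "w = complex_of_real t" "cmod (w - 2) = \<bar>t - 2\<bar>"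
  using assms cmod_of_real_minus_2 by (metis Reals_cases)

theorem orientation_preserving_classification:
  assumes "det A \<noteq> 0" and f: "f = moebius_map A"
  shows
    "(tr_inv A \<notin> \<real> \<longrightarrow> rotatory_hyperbolic 1 f \<and> \<not> stretch_half_turn f) \<and>
       (tr_inv A \<in> \<real> \<and> cmod (tr_inv A - 2) > 2 \<longrightarrow>
          (Re (tr_inv A) > 0 \<and> stretch f) \<or> (Re (tr_inv A) < 0 \<and> stretch_half_turn f)) \<and>
       (tr_inv A \<in> \<real> - {0} \<and> cmod (tr_inv A - 2) < 2 \<longrightarrow> rotatory_elliptic 1 f) \<and>
       (tr_inv A = 0 \<longrightarrow> half_turn f) \<and>
       (tr_inv A \<in> \<real> - {0} \<and> cmod (tr_inv A - 2) = 2 \<and> \<not> scalar_matrix A \<longrightarrow>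
          translation f) \<and>
       (tr_inv A \<in> \<real> - {0} \<and> cmod (tr_inv A - 2) = 2 \<and> scalar_matrix A \<longrightarrow> f = id)"
proof -
  have real: "\<exists>t. tr_inv A = complex_of_real t \<and> cmod (tr_inv A - 2) = \<bar>t - 2\<bar>" if "tr_inv A \<in> \<real>"
    using cmod_real_minus_2_cases[OF that] by metis
  have "rotatory_hyperbolic 1 f \<and> \<not> stretch_half_turn f" if "tr_inv A \<notin> \<real>"
    unfolding f using that rotatory_hyperbolic_if_tr_inv_not_real not_stretch_half_turn assms(1)
    by blast
  moreover have "(Re (tr_inv A) > 0 \<and> stretch f) \<or> (Re (tr_inv A) < 0 \<and> stretch_half_turn f)"
    if re: "tr_inv A \<in> \<real>" and gt: "cmod (tr_inv A - 2) > 2"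
  proof -
    obtain t where t: "tr_inv A = complex_of_real t" "cmod (tr_inv A - 2) = \<bar>t - 2\<bar>"
      using real re by auto
    then have "t < 0 \<or> t > 4"
      using gt by linarith
    then show ?thesis
      using stretch_or_stretch_half_turn[OF assms(1) t(1)] unfolding f t(1) Re_complex_of_real by blast
  qed
  moreover have "rotatory_elliptic 1 f" if re: "tr_inv A \<in> \<real>" and lt: "cmod (tr_inv A - 2) < 2"
  proof -
    obtain t where t: "tr_inv A = complex_of_real t" "cmod (tr_inv A - 2) = \<bar>t - 2\<bar>"
      using real re by blast
    then have "0 < t" "t < 4"
      using lt by linarith+
    then show ?thesis
      unfolding f by (rule rotatory_elliptic_if_tr_inv_small[OF assms(1) t(1)])
  qed
  moreover have "half_turn f" if "tr_inv A = 0"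
    unfolding f using half_turn_if_tr_inv_0 assms(1) that by blast
  moreover have "translation f"
    if re: "tr_inv A \<in> \<real> - {0}" and eq: "cmod (tr_inv A - 2) = 2" and "\<not> scalar_matrix A"
  proof -
    obtain t where t: "tr_inv A = complex_of_real t" "cmod (tr_inv A - 2) = \<bar>t - 2\<bar>"
      using real re by blast
    moreover have "t \<noteq> 0"
      using t re by auto
    ultimately have "t = 4"
      using eq by linarith
    then show ?thesis
      unfolding f using t(1) that(3) by (intro translation_if_tr_inv_4 assms(1)) simp_all
  qed
  moreover have "f = id" if "scalar_matrix A"
    using that assms(1) unfolding f scalar_matrix_def by (auto simp: det_2 moebius_map_scalar)
  ultimately show ?thesis
    by blast
qed

theorem orientation_reversing_classification:
  assumes "det A \<noteq> 0" and "B = A ** map_matrix cnj A" and f: "f = anti_moebius_map A"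
  shows
    "tr_inv B \<in> \<real> \<and> Re (tr_inv B) \<ge> 0 \<and>
       (cmod (tr_inv B - 2) < 2 \<longrightarrow> rotatory_elliptic_inversion 1 f) \<and>
       (cmod (tr_inv B - 2) > 2 \<longrightarrow> rotatory_hyperbolic_inversion 0 f) \<and>
       (tr_inv B \<noteq> 0 \<and> cmod (tr_inv B - 2) = 2 \<and> \<not> scalar_matrix B \<longrightarrow>
          rotatory_parabolic_inversion 0 f) \<and>
       (cmod (tr_inv B - 2) = 2 \<and> scalar_matrix B \<longrightarrow>
          (circle_inversion f \<or> antipodal_map f) \<and>
          elliptic_inversion f \<and>
          (\<exists>u. u \<noteq> 0 \<and> inversion_form (map_matrix ((*) u) A) \<and>
             (\<forall>v. v \<noteq> 0 \<and> inversion_form (map_matrix ((*) v) A) \<longrightarrow>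
                (\<exists>t::real. t \<noteq> 0 \<and> v = complex_of_real t * u))) \<and>
          (\<forall>u. u \<noteq> 0 \<and> inversion_form (map_matrix ((*) u) A) \<longrightarrow>
             (\<exists>d::real. det (map_matrix ((*) u) A) = complex_of_real d \<and>
                ((d < 0 \<and> circle_inversion f) \<or> (d > 0 \<and> antipodal_map f)))) \<and>
          (circle_inversion f \<longrightarrow> rotatory_elliptic_inversion 0 f) \<and>
          (antipodal_map f \<longrightarrow> rotatory_elliptic_inversion 1 f))"
proof -
  have B: "tr_inv B = complex_of_real ((anti_trace A)\<^sup>2)"
    using tr_inv_mult_cnj assms by simp
  have B2: "cmod (tr_inv B - 2) = \<bar>(anti_trace A)\<^sup>2 - 2\<bar>"
    unfolding B by (rule cmod_of_real_minus_2)
  have real: "tr_inv B \<in> \<real>" "Re (tr_inv B) \<ge> 0"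
    unfolding B by (simp_all del: of_real_power)
  have elliptic: "rotatory_elliptic_inversion 1 f" if "cmod (tr_inv B - 2) < 2"
  proof -
    have "0 < (anti_trace A)\<^sup>2" "(anti_trace A)\<^sup>2 < 4"
      using that unfolding B2 by linarith+
    then show ?thesis
      unfolding f by (rule rotatory_elliptic_inversion_if_anti_trace_small[OF assms(1)])
  qed
  have hyperbolic: "rotatory_hyperbolic_inversion 0 f" if "cmod (tr_inv B - 2) > 2"
  proof -
    have "(anti_trace A)\<^sup>2 > 4"
      using that zero_le_power2[of "anti_trace A"] unfolding B2 by linarith
    then show ?thesis
      unfolding f by (rule rotatory_hyperbolic_inversion_if_anti_trace_large[OF assms(1)])
  qed
  have parabolic: "rotatory_parabolic_inversion 0 f"
    if "tr_inv B \<noteq> 0" and eq: "cmod (tr_inv B - 2) = 2" and ns: "\<not> scalar_matrix B"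
  proof -
    \<comment> \<open>The equation | \<open>(anti_trace A)\<^sup>2\<close> - 2 | = 2 leaves the
      values 0 and 4; this excludes 0.\<close>
    have "(anti_trace A)\<^sup>2 \<noteq> 0"
      using that(1) B by auto
    then have "(anti_trace A)\<^sup>2 = 4"
      using eq unfolding B2 by linarith
    then show ?thesis
      unfolding f
      by (rule rotatory_parabolic_inversion_if_anti_trace_2[OF assms(1) _ ns[unfolded assms(2)]])
  qed
  have cases:
    "(circle_inversion f \<and> \<not> antipodal_map f \<and> rotatory_elliptic_inversion 0 f) \<or>
     (antipodal_map f \<and> \<not> circle_inversion f \<and> rotatory_elliptic_inversion 1 f)"
    if s: "scalar_matrix B"
    unfolding f by (rule square_scalar_cases[OF assms(1) s[unfolded assms(2)]])
  have circle_or_antipodal: "circle_inversion f \<or> antipodal_map f" if "scalar_matrix B"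
    using cases[OF that] by blast
  have elliptic_inv: "elliptic_inversion f" if "scalar_matrix B"
    using cases[OF that] unfolding elliptic_inversion_def by blast
  have circle: "rotatory_elliptic_inversion 0 f" if "scalar_matrix B" "circle_inversion f"
    using cases[OF that(1)] that(2) by blast
  have antipodal: "rotatory_elliptic_inversion 1 f" if "scalar_matrix B" "antipodal_map f"
    using cases[OF that(1)] that(2) by blast
  have inversion_form: "\<exists>u. u \<noteq> 0 \<and> inversion_form (map_matrix ((*) u) A) \<and>
             (\<forall>v. v \<noteq> 0 \<and> inversion_form (map_matrix ((*) v) A) \<longrightarrow>
                (\<exists>t::real. t \<noteq> 0 \<and> v = complex_of_real t * u))"
    if s: "scalar_matrix B"
  proof -
    obtain u where u: "u \<noteq> 0" "inversion_form (map_matrix ((*) u) A)"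
      by (rule inversion_form_exists[OF assms(1) s[unfolded assms(2)]])
    show ?thesis
      using u inversion_form_unique[OF assms(1) u(1) _ u(2)] by (intro exI[of _ u]) blast
  qed
  have sign: "\<exists>d::real. det (map_matrix ((*) u) A) = complex_of_real d \<and>
                ((d < 0 \<and> circle_inversion f) \<or> (d > 0 \<and> antipodal_map f))"
    if u: "u \<noteq> 0" "inversion_form (map_matrix ((*) u) A)" for u
  proof -
    obtain d where "det (map_matrix ((*) u) A) = complex_of_real d"
      "(d < 0 \<and> circle_inversion (anti_moebius_map A) \<and> anti_trace A = 2) \<or>
       (d > 0 \<and> antipodal_map (anti_moebius_map A) \<and> anti_trace A = - 2)"
      by (rule inversion_form_cases[OF assms(1) u])
    then show ?thesis
      unfolding f by (intro exI[of _ d]) blast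
  qed
  show ?thesis
    by (intro conjI impI allI; (elim conjE)?;
      (rule real elliptic hyperbolic parabolic circle_or_antipodal elliptic_inv circle antipodal
        inversion_form sign; assumption))
qed

theorem theoremA1:
  fixes A B :: "complex^2^2" and f :: "sphere \<Rightarrow> sphere"
  assumes "det A \<noteq> 0" and "B = A ** map_matrix cnj A"
  shows
    "(f = moebius_map A \<longrightarrow>
       (tr_inv A \<notin> \<real> \<longrightarrow> rotatory_hyperbolic 1 f \<and> \<not> stretch_half_turn f) \<and>
       (tr_inv A \<in> \<real> \<and> cmod (tr_inv A - 2) > 2 \<longrightarrow>
          (Re (tr_inv A) > 0 \<and> stretch f) \<or> (Re (tr_inv A) < 0 \<and> stretch_half_turn f)) \<and>
       (tr_inv A \<in> \<real> - {0} \<and> cmod (tr_inv A - 2) < 2 \<longrightarrow> rotatory_elliptic 1 f) \<and>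
       (tr_inv A = 0 \<longrightarrow> half_turn f) \<and>
       (tr_inv A \<in> \<real> - {0} \<and> cmod (tr_inv A - 2) = 2 \<and> \<not> scalar_matrix A \<longrightarrow>
          translation f) \<and>
       (tr_inv A \<in> \<real> - {0} \<and> cmod (tr_inv A - 2) = 2 \<and> scalar_matrix A \<longrightarrow> f = id)) \<and>
     (f = anti_moebius_map A \<longrightarrow>
       tr_inv B \<in> \<real> \<and> Re (tr_inv B) \<ge> 0 \<and>
       (cmod (tr_inv B - 2) < 2 \<longrightarrow> rotatory_elliptic_inversion 1 f) \<and>
       (cmod (tr_inv B - 2) > 2 \<longrightarrow> rotatory_hyperbolic_inversion 0 f) \<and>
       (tr_inv B \<noteq> 0 \<and> cmod (tr_inv B - 2) = 2 \<and> \<not> scalar_matrix B \<longrightarrow>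
          rotatory_parabolic_inversion 0 f) \<and>
       (cmod (tr_inv B - 2) = 2 \<and> scalar_matrix B \<longrightarrow>
          (circle_inversion f \<or> antipodal_map f) \<and>
          elliptic_inversion f \<and>
          (\<exists>u. u \<noteq> 0 \<and> inversion_form (map_matrix ((*) u) A) \<and>
             (\<forall>v. v \<noteq> 0 \<and> inversion_form (map_matrix ((*) v) A) \<longrightarrow>
                (\<exists>t::real. t \<noteq> 0 \<and> v = complex_of_real t * u))) \<and>
          (\<forall>u. u \<noteq> 0 \<and> inversion_form (map_matrix ((*) u) A) \<longrightarrow>
             (\<exists>d::real. det (map_matrix ((*) u) A) = complex_of_real d \<and>
                ((d < 0 \<and> circle_inversion f) \<or> (d > 0 \<and> antipodal_map f)))) \<and>
          (circle_inversion f \<longrightarrow> rotatory_elliptic_inversion 0 f) \<and>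
          (antipodal_map f \<longrightarrow> rotatory_elliptic_inversion 1 f)))"
proof (rule conjI; rule impI)
qed (rule orientation_preserving_classification[OF assms(1)] orientation_reversing_classification[OF assms];
    assumption)+

end
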